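(* Let $1<\alpha<\beta$. The set $[0,1]\cup[\alpha,\beta]$ is a spectral set if and only if either $\frac{\beta}{1+\beta-\alpha}$ is an integer, or $\alpha>1$ is an integer and $\beta=\alpha+1$.
   Context: A set $\Omega\subset\mathbb{R}$ of finite positive measure is a spectral set if there is a discrete set $\Lambda\subset\mathbb{R}$ such that $\{e_\lambda : \lambda\in\Lambda\}$, $e_\lambda(x)=e^{i2\pi\lambda x}$, is an orthogonal basis of $L^2(\Omega)$. *)

theory Defs
  imports "HOL-Analysis.Analysis"
begin

(* Elements of L^2(M) are represented by functions rather than by classes modulo
   null sets: two functions stand for the same element iff the L2_norm of their
   difference is 0. *)
definition L2_space :: "'a measure \<Rightarrow> ('a \<Rightarrow> complex) set" where
  "L2_space M = {f \<in> borel_measurable M. integrable M (\<lambda>x. (cmod (f x))\<^sup>2)}"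

definition L2_inner :: "'a measure \<Rightarrow> ('a \<Rightarrow> complex) \<Rightarrow> ('a \<Rightarrow> complex) \<Rightarrow> complex" where
  "L2_inner M f g = (LINT x|M. f x * cnj (g x))"

definition L2_norm :: "'a measure \<Rightarrow> ('a \<Rightarrow> complex) \<Rightarrow> real" where
  "L2_norm M f = sqrt (LINT x|M. (cmod (f x))\<^sup>2)"

(* Orthogonal basis in the Hilbert space sense: a pairwise orthogonal family of
   nonzero vectors whose finite complex linear combinations are dense in L^2(M). *)
definition L2_orthogonal_basis :: "'a measure \<Rightarrow> 'i set \<Rightarrow> ('i \<Rightarrow> 'a \<Rightarrow> complex) \<Rightarrow> bool" where
  "L2_orthogonal_basis M I e \<longleftrightarrow>
     (\<forall>i\<in>I. e i \<in> L2_space M \<and> L2_norm M (e i) \<noteq> 0) \<and>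
     (\<forall>i\<in>I. \<forall>j\<in>I. i \<noteq> j \<longrightarrow> L2_inner M (e i) (e j) = 0) \<and>
     (\<forall>f\<in>L2_space M. \<forall>\<epsilon>>0. \<exists>F c. finite F \<and> F \<subseteq> I \<and>
        L2_norm M (\<lambda>x. f x - (\<Sum>i\<in>F. c i * e i x)) < \<epsilon>)"

definition exp_freq :: "real \<Rightarrow> real \<Rightarrow> complex" where
  "exp_freq \<xi> x = exp (\<i> * complex_of_real (2 * pi * \<xi> * x))"

definition spectral_set :: "real set \<Rightarrow> bool" where
  "spectral_set \<Omega> \<longleftrightarrow>
     \<Omega> \<in> lmeasurable \<and> measure lebesgue \<Omega> > 0 \<and>
     (\<exists>\<Lambda>. discrete \<Lambda> \<and> L2_orthogonal_basis (lebesgue_on \<Omega>) \<Lambda> exp_freq)"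

end

theory Submission
  imports Defs
begin

text \<open>
  Write e(t) for exp (2 pi i t), and let L = 1 + \<beta> - \<alpha> be the total length of the two intervals.

  Necessity. Integrating an exponential over the two intervals shows that orthogonality of two
  frequencies with difference \<delta> means e(\<delta>) + e(\<delta>\<beta>) = 1 + e(\<delta>\<alpha>). Two pairs of unit complex numbers
  with the same sum are equal up to order, unless the sum is 0. Applying this to all differences
  at once (\<open>unit_triples_cases\<close>) leaves three shapes for a spectrum that contains 0: either it
  consists of integers; or all its members are annihilated by \<beta> and by \<alpha> - 1, where \<delta> is
  annihilated by d if \<delta> d is an integer; or it lies in the union of two cosets of the group of
  those \<delta> for which \<delta>, \<delta>\<alpha> and \<delta>\<beta> are all integers.

  Completeness enters through \<open>exponential_relation_imp_trivial\<close>: evaluations at finitely many points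
  of the set, restricted to the exponentials of a basis, are linearly independent, because a linear
  relation between them gives a step function orthogonal to the basis. Hence two points of the
  half-open intervals never differ by a common period of a spectrum containing 0, which excludes the
  first shape and forces \<beta> / L to be an integer for the second. In the third shape the
  exponentials take only two vectors of values at three points that are common periods of the group,
  and two equations for three coefficients have a nonzero solution; hence there are no three such
  points, and this makes \<alpha> and \<beta> integers with \<beta> = \<alpha> + 1.

  Sufficiency. If \<beta> = m L with m an integer, then \<alpha> = 1 + (m - 1) L, and moving the second interval
  by (m - 1) L to [1, L] identifies the set with a period of the L-periodic exponentials. If \<alpha> is an
  integer and \<beta> = \<alpha> + 1, the integers together with their translate by 1 / (2 \<alpha>) form a spectrum:
  the exponentials of the first coset agree, and those of the second have opposite signs, at points
  x and x + \<alpha>, so they take care of the even and odd parts under exchanging the intervals. Both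
  cases rest on the density of trigonometric polynomials in the square-integrable functions on an
  interval (\<open>trigonometric_polynomials_dense_L2\<close>), which follows from the Stone-Weierstrass theorem
  on the circle.
\<close>

section \<open>Exponentials\<close>

lemma exp_freq_eq_cis: "exp_freq \<xi> x = cis (2 * pi * \<xi> * x)"
  by (simp add: exp_freq_def cis_conv_exp)

lemma exp_freq_add_left: "exp_freq (\<xi> + \<eta>) x = exp_freq \<xi> x * exp_freq \<eta> x"
  by (simp add: exp_freq_eq_cis cis_mult algebra_simps)

lemma exp_freq_add_right: "exp_freq \<xi> (x + y) = exp_freq \<xi> x * exp_freq \<xi> y"
  by (simp add: exp_freq_eq_cis cis_mult algebra_simps)

lemma exp_freq_minus: "exp_freq (- \<xi>) x = cnj (exp_freq \<xi> x)"
  by (simp add: exp_freq_eq_cis cis_cnj)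

lemma exp_freq_diff_left: "exp_freq (\<xi> - \<eta>) x = exp_freq \<xi> x * cnj (exp_freq \<eta> x)"
  using exp_freq_add_left[of \<xi> "- \<eta>" x] by (simp add: exp_freq_minus)

lemma exp_freq_zero [simp]: "exp_freq 0 x = 1" "exp_freq \<xi> 0 = 1"
  by (simp_all add: exp_freq_def)

lemma norm_exp_freq [simp]: "cmod (exp_freq \<xi> x) = 1"
  by (simp add: exp_freq_eq_cis)

lemma exp_freq_nonzero [simp]: "exp_freq \<xi> x \<noteq> 0"
  by (simp add: exp_freq_def)

lemma exp_freq_times_cnj [simp]: "exp_freq \<xi> x * cnj (exp_freq \<xi> x) = 1"
  by (simp flip: complex_norm_square)

lemma exp_freq_eq_1_iff: "exp_freq \<xi> x = 1 \<longleftrightarrow> \<xi> * x \<in> \<int>"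
proof -
  have "exp_freq \<xi> x = 1 \<longleftrightarrow> (\<exists>n::int. 2 * pi * \<xi> * x = of_int (2 * n) * pi)"
    by (simp add: exp_freq_def exp_eq_1)
  also have "\<dots> \<longleftrightarrow> (\<exists>n::int. \<xi> * x = of_int n)"
    by (auto simp: mult.commute)
  also have "\<dots> \<longleftrightarrow> \<xi> * x \<in> \<int>"
    by (auto simp: Ints_def)
  finally show ?thesis .
qed

lemma exp_freq_eq_minus_1: 
  assumes "\<xi> * x - 1/2 \<in> \<int>"
  shows "exp_freq \<xi> x = -1"
proof -
  have "exp_freq 1 (\<xi> * x - 1/2) = 1"
    using assms by (simp add: exp_freq_eq_1_iff)
  moreover have "exp_freq \<xi> x = exp_freq 1 (\<xi> * x - 1/2) * exp_freq 1 (1/2)"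
    unfolding exp_freq_add_right[symmetric] by (simp add: exp_freq_def mult_ac)
  ultimately show ?thesis
    by (simp add: exp_freq_eq_cis)
qed

lemma continuous_on_exp_freq [continuous_intros]:
  "continuous_on S (exp_freq \<xi>)"
  unfolding exp_freq_def by (intro continuous_intros)

lemma exp_freq_measurable [measurable]: "exp_freq \<xi> \<in> borel_measurable borel"
  by (intro borel_measurable_continuous_onI continuous_on_exp_freq)

lemma exp_freq_measurable_lebesgue [measurable]:
  "exp_freq \<xi> \<in> borel_measurable (lebesgue_on S)" "exp_freq \<xi> \<in> borel_measurable lebesgue"
proof -
  show "exp_freq \<xi> \<in> borel_measurable lebesgue" 
    using exp_freq_measurable by (simp add: measurable_completion)
  then show "exp_freq \<xi> \<in> borel_measurable (lebesgue_on S)"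
    by (rule measurable_restrict_space1)
qed

section \<open>Square-integrable functions\<close>

lemma L2_norm_nonneg: "L2_norm M f \<ge> 0"
  by (simp add: L2_norm_def)

lemma L2_norm_power2: "(L2_norm M f)\<^sup>2 = (LINT x|M. (cmod (f x))\<^sup>2)"
  by (simp add: L2_norm_def)

lemma L2_norm_less_iff: "\<epsilon> > 0 \<Longrightarrow> L2_norm M f < \<epsilon> \<longleftrightarrow> (LINT x|M. (cmod (f x))\<^sup>2) < \<epsilon>\<^sup>2"
  by (metis L2_norm_nonneg L2_norm_power2 less_imp_le power_less_imp_less_base power_strict_mono zero_less_numeral)

lemma cmod_diff_power2_le: "(cmod (a - b))\<^sup>2 \<le> 2 * (cmod a)\<^sup>2 + 2 * (cmod b)\<^sup>2"
proof -
  have "(cmod (a - b))\<^sup>2 \<le> (cmod a + cmod b)\<^sup>2"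
    by (intro power_mono norm_triangle_ineq4) auto
  also have "\<dots> \<le> 2 * (cmod a)\<^sup>2 + 2 * (cmod b)\<^sup>2"
    using sum_squares_bound[of "cmod a" "cmod b"] by (simp add: power2_sum)
  finally show ?thesis .
qed

lemma L2_space_bounded:
  assumes "finite_measure M" "f \<in> borel_measurable M" "\<And>x. x \<in> space M \<Longrightarrow> cmod (f x) \<le> B"
  shows "f \<in> L2_space M"
proof -
  interpret finite_measure M by fact
  have [measurable]: "f \<in> borel_measurable M" by fact
  have "integrable M (\<lambda>x. (cmod (f x))\<^sup>2)"
    by (rule integrable_const_bound[of _ "B\<^sup>2"]) (auto simp: assms(3) intro!: AE_I2 power_mono)
  then show ?thesis
    using assms by (simp add: L2_space_def)
qed

lemma L2_space_diff:
  assumes "f \<in> L2_space M" "g \<in> L2_space M"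
  shows "(\<lambda>x. f x - g x) \<in> L2_space M"
proof -
  have [measurable]: "f \<in> borel_measurable M" "g \<in> borel_measurable M"
    using assms by (auto simp: L2_space_def)
  have "integrable M (\<lambda>x. 2 * (cmod (f x))\<^sup>2 + 2 * (cmod (g x))\<^sup>2)"
    using assms by (auto simp: L2_space_def)
  then have "integrable M (\<lambda>x. (cmod (f x - g x))\<^sup>2)"
    by (rule Bochner_Integration.integrable_bound) (auto intro!: AE_I2 cmod_diff_power2_le)
  then show ?thesis
    by (simp add: L2_space_def)
qed

lemma L2_space_cmult:
  assumes "f \<in> L2_space M"
  shows "(\<lambda>x. c * f x) \<in> L2_space M"
  using assms by (auto simp: L2_space_def norm_mult power_mult_distrib)

lemma L2_space_add:
  assumes "f \<in> L2_space M" "g \<in> L2_space M"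
  shows "(\<lambda>x. f x + g x) \<in> L2_space M"
  using L2_space_diff[OF assms(1) L2_space_cmult[OF assms(2), of "-1"]] by simp

lemma L2_space_sum:
  assumes "\<And>i. i \<in> F \<Longrightarrow> g i \<in> L2_space M"
  shows "(\<lambda>x. \<Sum>i\<in>F. c i * g i x) \<in> L2_space M"
  using assms
proof (induction F rule: infinite_finite_induct)
  case (insert i F)
  then show ?case 
    using L2_space_add[OF L2_space_cmult[of "g i"]] by simp
qed (auto simp: L2_space_def)

lemma L2_integrable_mult_cnj:
  assumes "f \<in> L2_space M" "g \<in> L2_space M"
  shows "integrable M (\<lambda>x. f x * cnj (g x))"
proof -
  have [measurable]: "f \<in> borel_measurable M" "g \<in> borel_measurable M"
    using assms by (auto simp: L2_space_def)
  have "integrable M (\<lambda>x. (cmod (f x))\<^sup>2 + (cmod (g x))\<^sup>2)"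
    using assms by (auto simp: L2_space_def)
  then show ?thesis
  proof (rule Bochner_Integration.integrable_bound)
    have "norm (a * cnj b) \<le> norm ((cmod a)\<^sup>2 + (cmod b)\<^sup>2)" for a b
    proof -
      have "2 * (cmod a * cmod b) \<le> (cmod a)\<^sup>2 + (cmod b)\<^sup>2"
        using sum_squares_bound[of "cmod a" "cmod b"] by simp
      moreover have "0 \<le> cmod a * cmod b" by simp
      ultimately have "cmod a * cmod b \<le> (cmod a)\<^sup>2 + (cmod b)\<^sup>2" by linarith
      then show ?thesis by (simp add: norm_mult)
    qed
    then show "AE x in M. norm (f x * cnj (g x)) \<le> norm ((cmod (f x))\<^sup>2 + (cmod (g x))\<^sup>2)"
      by auto
    have [measurable]: "cnj \<in> borel_measurable borel"
      by (intro borel_measurable_continuous_onI continuous_intros)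
    show "(\<lambda>x. f x * cnj (g x)) \<in> borel_measurable M" by measurable
  qed
qed

text \<open>This substitute for the triangle inequality loses a factor 2 but avoids the Minkowski
  inequality; for approximation arguments it is enough.\<close>
lemma L2_norm_diff_power2_le:
  assumes "f \<in> L2_space M" "g \<in> L2_space M" "h \<in> L2_space M"
  shows "(LINT x|M. (cmod (f x - h x))\<^sup>2) 
    \<le> 2 * (LINT x|M. (cmod (f x - g x))\<^sup>2) + 2 * (LINT x|M. (cmod (g x - h x))\<^sup>2)"
proof -
  have 1: "integrable M (\<lambda>x. (cmod (f x - g x))\<^sup>2)" "integrable M (\<lambda>x. (cmod (g x - h x))\<^sup>2)" 
     "integrable M (\<lambda>x. (cmod (f x - h x))\<^sup>2)"
    using L2_space_diff assms by (auto simp: L2_space_def)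
  have "(LINT x|M. (cmod (f x - h x))\<^sup>2) \<le> (LINT x|M. 2 * (cmod (f x - g x))\<^sup>2 + 2 * (cmod (g x - h x))\<^sup>2)"
  proof (rule integral_mono)
    fix x
    show "(cmod (f x - h x))\<^sup>2 \<le> 2 * (cmod (f x - g x))\<^sup>2 + 2 * (cmod (g x - h x))\<^sup>2"
      using cmod_diff_power2_le[of "f x - g x" "h x - g x"] by (simp add: norm_minus_commute)
  qed (use 1 in auto)
  then show ?thesis using 1 by simp
qed

text \<open>By Pythagoras, no combination g of the basis comes closer to a function f orthogonal to the
  basis than 0 does, so density forces f to have norm 0.\<close>
lemma orthogonal_to_basis_imp_null:
  assumes basis: "L2_orthogonal_basis M I e" and f: "f \<in> L2_space M"
    and orth: "\<And>i. i \<in> I \<Longrightarrow> L2_inner M f (e i) = 0"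
  shows "L2_norm M f = 0"
proof (rule ccontr)
  assume "L2_norm M f \<noteq> 0"
  then have pos: "L2_norm M f > 0" using L2_norm_nonneg[of M f] by simp
  then obtain F c where F: "finite F" "F \<subseteq> I"
    and less: "L2_norm M (\<lambda>x. f x - (\<Sum>i\<in>F. c i * e i x)) < L2_norm M f"
    using basis f unfolding L2_orthogonal_basis_def by blast
  define g where "g = (\<lambda>x. \<Sum>i\<in>F. c i * e i x)"
  have eL2: "e i \<in> L2_space M" if "i \<in> F" for i
    using basis F that by (auto simp: L2_orthogonal_basis_def)
  have g: "g \<in> L2_space M"
    unfolding g_def by (intro L2_space_sum eL2)
  have "(LINT x|M. f x * cnj (g x)) = (LINT x|M. (\<Sum>i\<in>F. cnj (c i) * (f x * cnj (e i x))))"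
    by (simp add: g_def sum_distrib_left mult_ac)
  also have "\<dots> = (\<Sum>i\<in>F. LINT x|M. cnj (c i) * (f x * cnj (e i x)))"
    by (intro Bochner_Integration.integral_sum integrable_mult_right L2_integrable_mult_cnj f eL2)
  also have "\<dots> = (\<Sum>i\<in>F. cnj (c i) * L2_inner M f (e i))"
    by (simp add: L2_inner_def)
  also have "\<dots> = 0"
    using orth F by (intro sum.neutral) auto
  finally have fg: "(LINT x|M. f x * cnj (g x)) = 0" .
  have int: "integrable M (\<lambda>x. (cmod (f x))\<^sup>2)" "integrable M (\<lambda>x. (cmod (g x))\<^sup>2)" "integrable M (\<lambda>x. f x * cnj (g x))"
    using f g by (auto simp: L2_space_def intro: L2_integrable_mult_cnj)
  have "(LINT x|M. (cmod (f x - g x))\<^sup>2) = (LINT x|M. (cmod (f x))\<^sup>2 + (cmod (g x))\<^sup>2 - 2 * Re (f x * cnj (g x)))"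
  proof (rule Bochner_Integration.integral_cong)
    fix x
    show "(cmod (f x - g x))\<^sup>2 = (cmod (f x))\<^sup>2 + (cmod (g x))\<^sup>2 - 2 * Re (f x * cnj (g x))"
      unfolding cmod_power2 by (simp add: power2_eq_square algebra_simps)
  qed simp
  also have "\<dots> = (LINT x|M. (cmod (f x))\<^sup>2) + (LINT x|M. (cmod (g x))\<^sup>2) - 2 * Re (LINT x|M. f x * cnj (g x))"
    using int by (simp add: integrable_Re del: times_complex.sel)
  finally have "(LINT x|M. (cmod (f x - g x))\<^sup>2) \<ge> (LINT x|M. (cmod (f x))\<^sup>2)"
    by (simp add: fg)
  then have "L2_norm M (\<lambda>x. f x - g x) \<ge> L2_norm M f"
    by (simp add: L2_norm_def)
  then show False using less by (simp add: g_def)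
qed

section \<open>Independence of an exponential basis at finitely many points\<close>

lemma integral_lebesgue_on_eq:
  fixes f :: "real \<Rightarrow> 'b::{banach, second_countable_topology}"
  assumes "S \<in> sets lebesgue"
  shows "integral\<^sup>L (lebesgue_on S) f = (LINT x|lebesgue. indicator S x *\<^sub>R f x)"
  using assms by (intro integral_restrict_space) auto

lemma integral_lebesgue_on_translate:
  fixes f :: "real \<Rightarrow> 'b::euclidean_space"
  assumes "S \<in> sets lebesgue" "T \<in> sets lebesgue" and shift: "\<And>x. x \<in> S \<longleftrightarrow> x + t \<in> T"
  shows "integral\<^sup>L (lebesgue_on T) f = integral\<^sup>L (lebesgue_on S) (\<lambda>x. f (x + t))"
proof -
  have "integral\<^sup>L (lebesgue_on T) f = (LINT x|lebesgue. indicator T x *\<^sub>R f x)"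
    by (rule integral_lebesgue_on_eq) fact
  also have "\<dots> = (LINT x|lebesgue. indicator T (t + 1 * x) *\<^sub>R f (t + 1 * x))"
    by (subst lebesgue_integral_real_affine[of 1 _ t]) auto
  also have "\<dots> = (LINT x|lebesgue. indicator S x *\<^sub>R f (x + t))"
    using shift by (intro Bochner_Integration.integral_cong) (auto simp: indicator_def add.commute)
  also have "\<dots> = integral\<^sup>L (lebesgue_on S) (\<lambda>x. f (x + t))"
    by (rule integral_lebesgue_on_eq[symmetric]) fact
  finally show ?thesis .
qed

lemma integral_lebesgue_on_indicator:
  fixes f :: "real \<Rightarrow> 'b::{banach, second_countable_topology}"
  assumes "S \<in> sets lebesgue" "T \<in> sets lebesgue" "S \<subseteq> T"
  shows "(LINT x|lebesgue_on T. indicator S x *\<^sub>R f x) = integral\<^sup>L (lebesgue_on S) f"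
proof -
  have "(\<lambda>x. indicator T x *\<^sub>R indicator S x *\<^sub>R f x) = (\<lambda>x. indicator S x *\<^sub>R f x)"
    using assms by (auto simp: indicator_def fun_eq_iff)
  then show ?thesis
    using assms by (simp only: integral_lebesgue_on_eq)
qed

lemma integral_lebesgue_on_Un:
  fixes f :: "real \<Rightarrow> 'b::{banach, second_countable_topology}"
  assumes S: "S \<in> sets lebesgue" and T: "T \<in> sets lebesgue" and disj: "S \<inter> T = {}"
    and int: "integrable (lebesgue_on (S \<union> T)) f"
  shows "integral\<^sup>L (lebesgue_on (S \<union> T)) f = integral\<^sup>L (lebesgue_on S) f + integral\<^sup>L (lebesgue_on T) f"
proof -
  have int: "integrable lebesgue (\<lambda>x. indicator (S \<union> T) x *\<^sub>R f x)"
    using S T int by (subst (asm) integrable_restrict_space) auto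
  have "integrable lebesgue (\<lambda>x. indicator U x *\<^sub>R f x)" if "U \<in> sets lebesgue" "U \<subseteq> S \<union> T" for U
  proof -
    have "(\<lambda>x. indicator U x *\<^sub>R indicator (S \<union> T) x *\<^sub>R f x) = (\<lambda>x. indicator U x *\<^sub>R f x)"
      using that(2) by (auto simp: indicator_def fun_eq_iff)
    then show ?thesis
      using integrable_mult_indicator[OF that(1) int] by simp
  qed
  moreover have "(\<lambda>x. indicator (S \<union> T) x *\<^sub>R f x) = (\<lambda>x. indicator S x *\<^sub>R f x + indicator T x *\<^sub>R f x)"
    using disj by (auto simp: indicator_def fun_eq_iff)
  ultimately show ?thesis
    using S T by (simp add: integral_lebesgue_on_eq del: Int_Un_eq)
qed

text \<open>If the values of all exponentials of the basis at the points of P satisfy a linear relation,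
  then so do their integrals over the intervals [x, x + d], because the integral of an exponential
  over [x, x + d] is its value at x times a factor that does not depend on x. The corresponding step
  function is therefore orthogonal to the basis, hence null.\<close>
lemma exponential_relation_imp_trivial:
  fixes c :: "real \<Rightarrow> complex"
  assumes basis: "L2_orthogonal_basis (lebesgue_on \<Omega>) \<Lambda> exp_freq"
    and \<Omega>: "\<Omega> \<in> lmeasurable" and "finite P"
    and room: "\<And>x. x \<in> P \<Longrightarrow> \<exists>\<delta>>0. {x..x+\<delta>} \<subseteq> \<Omega>"
    and rel: "\<And>l. l \<in> \<Lambda> \<Longrightarrow> (\<Sum>x\<in>P. c x * exp_freq l x) = 0"
    and y: "y \<in> P"
  shows "c y = 0"
proof -
  have "\<forall>\<^sub>F d in at_right 0. \<forall>x\<in>P. {x..x+d} \<subseteq> \<Omega>"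
  proof (intro eventually_ball_finite ballI \<open>finite P\<close>)
    fix x assume "x \<in> P"
    then obtain \<delta> where \<delta>: "\<delta> > 0" "{x..x+\<delta>} \<subseteq> \<Omega>" using room by blast
    then have "{x..x+d} \<subseteq> \<Omega>" if "0 < d" "d < \<delta>" for d
      using that by force
    then show "\<forall>\<^sub>F d in at_right 0. {x..x+d} \<subseteq> \<Omega>"
      using \<delta>(1) by (auto simp: eventually_at_right_field)
  qed
  moreover have "\<forall>\<^sub>F d in at_right 0. \<forall>x\<in>P - {y}. {x..x+d} \<inter> {y..y+d} = {}"
  proof (intro eventually_ball_finite ballI finite_Diff \<open>finite P\<close>)
    fix x assume "x \<in> P - {y}"
    then have "\<bar>x - y\<bar> > 0" by auto
    moreover have "{x..x+d} \<inter> {y..y+d} = {}" if "0 < d" "d < \<bar>x - y\<bar>" for d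
      using that by auto
    ultimately show "\<forall>\<^sub>F d in at_right 0. {x..x+d} \<inter> {y..y+d} = {}"
      unfolding eventually_at_right_field by blast
  qed
  moreover have "\<forall>\<^sub>F d in at_right (0::real). d > 0"
    by (rule eventually_at_right_less)
  ultimately have "\<forall>\<^sub>F d in at_right 0. (\<forall>x\<in>P. {x..x+d} \<subseteq> \<Omega>) \<and>
      (\<forall>x\<in>P - {y}. {x..x+d} \<inter> {y..y+d} = {}) \<and> d > 0"
    by (simp add: eventually_conj_iff)
  from eventually_happens'[OF _ this] obtain d where "(\<forall>x\<in>P. {x..x+d} \<subseteq> \<Omega>) \<and>
      (\<forall>x\<in>P - {y}. {x..x+d} \<inter> {y..y+d} = {}) \<and> d > 0"
    by auto
  then have d: "\<And>x. x \<in> P \<Longrightarrow> {x..x+d} \<subseteq> \<Omega>" "d > 0"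
      "\<And>x. x \<in> P \<Longrightarrow> x \<noteq> y \<Longrightarrow> {x..x+d} \<inter> {y..y+d} = {}"
    by blast+
  \<comment> \<open>The coefficients are conjugated because the inner product is conjugate linear in the exponential.\<close>
  define f :: "real \<Rightarrow> complex" where "f = (\<lambda>t. \<Sum>x\<in>P. cnj (c x) * indicator {x..x+d} t)"
  have [simp]: "\<Omega> \<in> sets lebesgue" using \<Omega> by auto
  have f: "f \<in> L2_space (lebesgue_on \<Omega>)"
    unfolding f_def
  proof (intro L2_space_sum L2_space_bounded)
    fix x :: real 
    show "finite_measure (lebesgue_on \<Omega>)" using \<Omega> by (rule finite_measure_lebesgue_on)
    show "indicator {x..x+d} \<in> borel_measurable (lebesgue_on \<Omega>)"
      by (intro measurable_restrict_space1 borel_measurable_indicator) auto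
    show "cmod (indicator {x..x+d} t) \<le> 1" for t by (simp add: indicator_def)
  qed
  have "L2_inner (lebesgue_on \<Omega>) f (exp_freq l) = 0" if l: "l \<in> \<Lambda>" for l
  proof -
    define J where "J = (LINT s|lebesgue_on {0..d}. cnj (exp_freq l s))"
    have int: "integrable (lebesgue_on \<Omega>) (\<lambda>t. indicator {x..x+d} t *\<^sub>R cnj (exp_freq l t))" for x
    proof (rule finite_measure.integrable_const_bound[of _ _ 1])
      show "finite_measure (lebesgue_on \<Omega>)" using \<Omega> by (rule finite_measure_lebesgue_on)
      have "(\<lambda>t. cnj (exp_freq l t)) \<in> borel_measurable (lebesgue_on \<Omega>)"
        unfolding exp_freq_minus[symmetric] by measurable
      then show "(\<lambda>t. indicator {x..x+d} t *\<^sub>R cnj (exp_freq l t)) \<in> borel_measurable (lebesgue_on \<Omega>)"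
        by (intro borel_measurable_scaleR measurable_restrict_space1[OF borel_measurable_indicator]) auto
    qed (auto simp: indicator_def)
    have piece: "(LINT t|lebesgue_on \<Omega>. indicator {x..x+d} t *\<^sub>R cnj (exp_freq l t)) = cnj (exp_freq l x) * J"
      if "x \<in> P" for x
    proof -
      have "(LINT t|lebesgue_on \<Omega>. indicator {x..x+d} t *\<^sub>R cnj (exp_freq l t)) 
          = (LINT t|lebesgue_on {x..x+d}. cnj (exp_freq l t))"
        by (rule integral_lebesgue_on_indicator) (use d(1) that in auto)
      also have "\<dots> = (LINT s|lebesgue_on {0..d}. cnj (exp_freq l (s + x)))"
        by (intro integral_lebesgue_on_translate) auto
      also have "\<dots> = cnj (exp_freq l x) * J"
        by (simp add: exp_freq_add_right J_def mult.commute)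
      finally show ?thesis .
    qed
    have "L2_inner (lebesgue_on \<Omega>) f (exp_freq l)
       = (LINT t|lebesgue_on \<Omega>. (\<Sum>x\<in>P. cnj (c x) * (indicator {x..x+d} t *\<^sub>R cnj (exp_freq l t))))"
      unfolding L2_inner_def f_def
      by (intro Bochner_Integration.integral_cong) 
         (auto simp: sum_distrib_right indicator_def intro!: sum.cong)
    also have "\<dots> = (\<Sum>x\<in>P. LINT t|lebesgue_on \<Omega>. cnj (c x) * (indicator {x..x+d} t *\<^sub>R cnj (exp_freq l t)))"
      by (intro Bochner_Integration.integral_sum integrable_mult_right int)
    also have "\<dots> = (\<Sum>x\<in>P. cnj (c x) * (cnj (exp_freq l x) * J))"
      by (intro sum.cong refl) (simp only: integral_mult_right_zero piece)
    also have "\<dots> = cnj (\<Sum>x\<in>P. c x * exp_freq l x) * J"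
      by (simp add: sum_distrib_right mult.assoc)
    finally show ?thesis using rel[OF l] by simp
  qed
  then have "L2_norm (lebesgue_on \<Omega>) f = 0"
    by (rule orthogonal_to_basis_imp_null[OF basis f])
  then have null: "(LINT t|lebesgue_on \<Omega>. (cmod (f t))\<^sup>2) = 0"
    by (simp add: L2_norm_def)
  have fy: "f t = cnj (c y)" if "t \<in> {y..y+d}" for t
  proof -
    have "f t = cnj (c y) * indicator {y..y+d} t + (\<Sum>x\<in>P - {y}. cnj (c x) * indicator {x..x+d} t)"
      unfolding f_def by (rule sum.remove[OF \<open>finite P\<close> y])
    also have "(\<Sum>x\<in>P - {y}. cnj (c x) * indicator {x..x+d} t) = 0"
    proof (intro sum.neutral ballI)
      fix x assume "x \<in> P - {y}"
      then have "t \<notin> {x..x+d}" using d(3)[of x] that by blast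
      then show "cnj (c x) * indicator {x..x+d} t = 0" by simp
    qed
    finally show ?thesis using that by simp
  qed
  have "d * (cmod (c y))\<^sup>2 = (LINT t|lebesgue_on {y..y+d}. (cmod (c y))\<^sup>2)"
    using d(2) by (simp add: measure_restrict_space)
  also have "\<dots> = (LINT t|lebesgue_on \<Omega>. indicator {y..y+d} t *\<^sub>R (cmod (c y))\<^sup>2)"
    by (rule integral_lebesgue_on_indicator[symmetric]) (use d(1) y in auto)
  also have "\<dots> \<le> (LINT t|lebesgue_on \<Omega>. (cmod (f t))\<^sup>2)"
  proof (rule integral_mono)
    show "integrable (lebesgue_on \<Omega>) (\<lambda>t. (cmod (f t))\<^sup>2)" using f by (simp add: L2_space_def)
    show "integrable (lebesgue_on \<Omega>) (\<lambda>t. indicator {y..y+d} t *\<^sub>R (cmod (c y))\<^sup>2)"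
    proof (rule finite_measure.integrable_const_bound[of _ _ "(cmod (c y))\<^sup>2"])
      show "finite_measure (lebesgue_on \<Omega>)" using \<Omega> by (rule finite_measure_lebesgue_on)
      show "(\<lambda>t. indicator {y..y+d} t *\<^sub>R (cmod (c y))\<^sup>2) \<in> borel_measurable (lebesgue_on \<Omega>)"
        by (intro borel_measurable_scaleR measurable_restrict_space1[OF borel_measurable_indicator]) auto
    qed (auto simp: indicator_def)
    show "indicator {y..y+d} t *\<^sub>R (cmod (c y))\<^sup>2 \<le> (cmod (f t))\<^sup>2" for t
      using fy[of t] by (auto simp: indicator_def)
  qed
  finally show ?thesis
    using null \<open>d > 0\<close> by (simp add: mult_le_0_iff)
qed

section \<open>Orthogonality of exponentials on two intervals\<close>

lemma exp_freq_integral_interval: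
  assumes "\<xi> \<noteq> 0" "a \<le> b"
  shows "(LINT x|lebesgue_on {a..b}. exp_freq \<xi> x) = (exp_freq \<xi> b - exp_freq \<xi> a) / (\<i> * complex_of_real (2 * pi * \<xi>))"
proof -
  have "integrable (lebesgue_on {a..b}) (exp_freq \<xi>)"
    by (intro finite_measure.integrable_const_bound[of _ _ 1] finite_measure_lebesgue_on exp_freq_measurable_lebesgue) auto
  then have "(LINT x|lebesgue_on {a..b}. exp_freq \<xi> x) = integral {a..b} (exp_freq \<xi>)"
    by (intro lebesgue_integral_eq_integral) auto
  also have "(exp_freq \<xi> has_integral 
      (exp_freq \<xi> b / (\<i> * complex_of_real (2 * pi * \<xi>)) - exp_freq \<xi> a / (\<i> * complex_of_real (2 * pi * \<xi>)))) {a..b}"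
  proof (rule fundamental_theorem_of_calculus[OF assms(2)])
    fix x
    have "((\<lambda>z. exp (\<i> * complex_of_real (2 * pi * \<xi>) * z) / (\<i> * complex_of_real (2 * pi * \<xi>))) has_field_derivative exp_freq \<xi> x)
      (at (of_real x))"
      by (rule derivative_eq_intros refl | use assms in \<open>simp add: exp_freq_def mult_ac\<close>)+
    then show "((\<lambda>x. exp_freq \<xi> x / (\<i> * complex_of_real (2 * pi * \<xi>))) has_vector_derivative exp_freq \<xi> x) (at x within {a..b})"
      using has_vector_derivative_real_field[of _ _ x "{a..b}"] by (fastforce simp: exp_freq_def mult_ac)
  qed
  then have "integral {a..b} (exp_freq \<xi>) = exp_freq \<xi> b / (\<i> * complex_of_real (2 * pi * \<xi>)) - exp_freq \<xi> a / (\<i> * complex_of_real (2 * pi * \<xi>))"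
    by (rule integral_unique)
  finally show ?thesis by (simp add: diff_divide_distrib)
qed

lemma L2_inner_exp_freq_two_intervals:
  assumes "0 \<le> r" "r < \<alpha>" "\<alpha> \<le> \<beta>" "l \<noteq> m"
  shows "L2_inner (lebesgue_on ({0..r} \<union> {\<alpha>..\<beta>})) (exp_freq l) (exp_freq m) = 0 \<longleftrightarrow>
    exp_freq (l - m) r + exp_freq (l - m) \<beta> = 1 + exp_freq (l - m) \<alpha>"
proof -
  let ?\<Omega> = "{0..r} \<union> {\<alpha>..\<beta>}"
  have "?\<Omega> \<in> lmeasurable" by (intro fmeasurable.Un) auto
  then have "integrable (lebesgue_on ?\<Omega>) (exp_freq (l - m))"
    by (intro finite_measure.integrable_const_bound[of _ _ 1] finite_measure_lebesgue_on exp_freq_measurable_lebesgue) auto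
  moreover have "{0..r} \<inter> {\<alpha>..\<beta>} = {}" using assms(2) by auto
  ultimately have "(LINT x|lebesgue_on ?\<Omega>. exp_freq (l - m) x) =
     (LINT x|lebesgue_on {0..r}. exp_freq (l - m) x) + (LINT x|lebesgue_on {\<alpha>..\<beta>}. exp_freq (l - m) x)"
    by (intro integral_lebesgue_on_Un) auto
  then have "L2_inner (lebesgue_on ?\<Omega>) (exp_freq l) (exp_freq m) = 
     (exp_freq (l - m) r - 1 + (exp_freq (l - m) \<beta> - exp_freq (l - m) \<alpha>)) / (\<i> * complex_of_real (2 * pi * (l - m)))"
    unfolding L2_inner_def exp_freq_diff_left[symmetric]
    using assms by (simp add: exp_freq_integral_interval add_divide_distrib)
  moreover have "\<i> * complex_of_real (2 * pi * (l - m)) \<noteq> 0" using assms by simp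
  moreover have "z - 1 + (w - v) = 0 \<longleftrightarrow> z + w = 1 + v" for z w v :: complex
    by (auto simp: algebra_simps eq_diff_eq add_eq_0_iff)
  ultimately show ?thesis by simp
qed

lemma cnj_unit:
  assumes "cmod z = 1"
  shows "cnj z = 1 / z"
proof -
  have "z * cnj z = 1" "z \<noteq> 0" using assms by (auto simp flip: complex_norm_square)
  then show ?thesis by (simp add: field_simps)
qed

text \<open>Conjugation inverts unit numbers, so unless the common sum vanishes the products a y and z also
  agree, and a, y are the roots of the quadratic polynomial with roots 1 and z.\<close>
lemma unit_sum_cases:
  fixes a y z :: complex
  assumes unit: "cmod a = 1" "cmod y = 1" "cmod z = 1" and eq: "a + y = 1 + z"
  shows "a = 1 \<and> y = z \<or> a = z \<and> y = 1 \<or> z = -1 \<and> y = - a"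
proof (cases "z = -1")
  case True
  then show ?thesis using eq by (auto simp: add_eq_0_iff2 add_eq_0_iff)
next
  case False
  have nz: "a \<noteq> 0" "y \<noteq> 0" "z \<noteq> 0" using unit by auto
  have "1 / a + 1 / y = 1 + 1 / z"
    using arg_cong[OF eq, of cnj] by (simp add: cnj_unit unit)
  then have "(a + y) * z = (1 + z) * (a * y)"
    using nz by (simp add: field_simps)
  then have "(1 + z) * (z - a * y) = 0"
    unfolding eq by (simp add: algebra_simps)
  then have "z = a * y"
    using False by (simp add: add_eq_0_iff)
  \<comment> \<open>The quadratic polynomial with roots 1 and z, evaluated at a.\<close>
  have "(a - 1) * (a - z) = a * a - a * (1 + z) + z"
    by (simp add: algebra_simps)
  also have "\<dots> = a * a - a * (a + y) + a * y"
    by (simp only: eq) (simp only: \<open>z = a * y\<close>)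
  also have "\<dots> = 0"
    by (simp add: algebra_simps)
  finally show ?thesis using eq by auto
qed

text \<open>The index set has a base point p at which all three functions are 1, so every single index falls
  under one of the three alternatives of the preceding lemma. An index k that satisfies only the third,
  z = -1 and y = -a, is incompatible with everything except the trivial triple and its own triple. If
  there is none, indices of the first and of the second kind can coexist only if one of the kinds is
  represented by trivial triples alone.\<close>
lemma unit_triples_cases:
  fixes a y z :: "'i \<Rightarrow> complex"
  assumes unit: "\<And>l. l \<in> S \<Longrightarrow> cmod (a l) = 1" "\<And>l. l \<in> S \<Longrightarrow> cmod (y l) = 1" "\<And>l. l \<in> S \<Longrightarrow> cmod (z l) = 1"
    and rel: "\<And>l m. l \<in> S \<Longrightarrow> m \<in> S \<Longrightarrow> a l / a m + y l / y m = 1 + z l / z m"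
    and p: "p \<in> S" "a p = 1" "y p = 1" "z p = 1"
  shows "(\<forall>l\<in>S. a l = 1) \<or> (\<forall>l\<in>S. y l = 1 \<and> z l = a l) \<or>
    (\<exists>k\<in>S. \<forall>l\<in>S. a l = 1 \<and> y l = 1 \<and> z l = 1 \<or> a l = a k \<and> y l = y k \<and> z l = z k)"
proof -
  have nz: "a l \<noteq> 0" "y l \<noteq> 0" "z l \<noteq> 0" if "l \<in> S" for l
    using unit[OF that] by auto
  have pair: "a l = a m \<and> y l * z m = z l * y m \<or> a l * z m = z l * a m \<and> y l = y m \<or> z l = - z m \<and> y l * a m = - a l * y m"
    if "l \<in> S" "m \<in> S" for l m
    using unit_sum_cases[OF _ _ _ rel[OF that]] nz[OF that(1)] nz[OF that(2)]
    by (simp add: norm_divide unit that field_simps)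
  have single: "a l = 1 \<and> y l = z l \<or> a l = z l \<and> y l = 1 \<or> z l = -1 \<and> y l = - a l" if "l \<in> S" for l
    using pair[OF that p(1)] p by auto
  show ?thesis
  proof (cases "\<exists>k\<in>S. z k = -1 \<and> y k = - a k \<and> a k \<noteq> 1 \<and> a k \<noteq> -1")
    case True
    then obtain k where k: "k \<in> S" "z k = -1" "y k = - a k" "a k \<noteq> 1" "a k \<noteq> -1" by blast
    have sq: "a k * a k \<noteq> 1" using k by (simp add: square_eq_1_iff)
    have "a l = 1 \<and> y l = 1 \<and> z l = 1 \<or> a l = a k \<and> y l = y k \<and> z l = z k" if l: "l \<in> S" for l
      using single[OF l]
    proof (elim disjE)
      assume l1: "a l = 1 \<and> y l = z l"
      then have "a k * z l = -1 \<and> z l = - a k \<or> z l = 1"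
        using pair[OF k(1) l] k by auto
      then show ?thesis using l1 sq by auto
    next
      assume "a l = z l \<and> y l = 1"
      then show ?thesis using pair[OF k(1) l] k sq nz[OF l] by (auto simp: minus_equation_iff)
    next
      assume "z l = -1 \<and> y l = - a l"
      then show ?thesis using pair[OF k(1) l] k by auto
    qed
    then show ?thesis using k by blast
  next
    case False
    then have AB: "a l = 1 \<and> y l = z l \<or> a l = z l \<and> y l = 1" if "l \<in> S" for l
      using single[OF that] that by force
    have "False" if lm: "l \<in> S" "m \<in> S" "a m \<noteq> 1" "\<not> (y l = 1 \<and> z l = a l)" for l m
    proof -
      have m: "a m = z m" "y m = 1" and l: "a l = 1" "y l = z l" using AB[OF lm(1)] AB[OF lm(2)] lm(3,4) by auto
      moreover have "z m \<noteq> 0" using nz lm by blast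
      ultimately have "z l = - z m" "z l * z m = - 1"
        using pair[OF lm(1,2)] lm(3,4) by auto
      then have "z m * z m = 1" by simp
      then show False using m l lm \<open>z l = - z m\<close> by (auto simp: square_eq_1_iff)
    qed
    then show ?thesis by blast
  qed
qed

section \<open>Necessity\<close>

context
  fixes \<alpha> \<beta> :: real and \<Omega> \<Lambda>
  assumes \<alpha>\<beta>: "1 < \<alpha>" "\<alpha> < \<beta>"
  defines "\<Omega> \<equiv> {0..1} \<union> {\<alpha>..\<beta>}"
  assumes basis: "L2_orthogonal_basis (lebesgue_on \<Omega>) \<Lambda> exp_freq"
begin

text \<open>Subtracting a fixed frequency m from the spectrum multiplies the exponentials by a nowhere
  vanishing function, which the coefficients absorb. This allows the later arguments to pretend
  that 0 belongs to the spectrum.\<close>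
lemma shifted_relation_trivial:
  assumes "finite P" "P \<subseteq> {0..<1} \<union> {\<alpha>..<\<beta>}"
    and rel: "\<And>l. l \<in> \<Lambda> \<Longrightarrow> (\<Sum>x\<in>P. c x * exp_freq (l - m) x) = 0" and "y \<in> P"
  shows "c y = 0"
proof -
  have "c y * cnj (exp_freq m y) = 0"
  proof (rule exponential_relation_imp_trivial[OF basis _ \<open>finite P\<close> _ _ \<open>y \<in> P\<close>])
    show "\<Omega> \<in> lmeasurable" unfolding \<Omega>_def by (intro fmeasurable.Un) auto
    show "\<exists>\<delta>>0. {x..x+\<delta>} \<subseteq> \<Omega>" if "x \<in> P" for x
    proof -
      have "x \<in> {0..<1} \<union> {\<alpha>..<\<beta>}" using assms(2) that by blast
      then consider "0 \<le> x" "x < 1" | "\<alpha> \<le> x" "x < \<beta>" by auto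
      then show ?thesis
      proof cases
        case 1 then show ?thesis by (intro exI[of _ "1 - x"]) (auto simp: \<Omega>_def)
      next
        case 2 then show ?thesis by (intro exI[of _ "\<beta> - x"]) (auto simp: \<Omega>_def)
      qed
    qed
    show "(\<Sum>x\<in>P. c x * cnj (exp_freq m x) * exp_freq l x) = 0" if "l \<in> \<Lambda>" for l
      using rel[OF that] by (simp add: exp_freq_diff_left mult_ac)
  qed
  then show ?thesis by simp
qed

lemma spectrum_nonempty: "\<Lambda> \<noteq> {}"
proof
  assume "\<Lambda> = {}"
  then have "(1::complex) = 0"
    by (intro shifted_relation_trivial[of "{0}" "\<lambda>_. 1" 0 0]) auto
  then show False by simp
qed

lemma not_equal_at_two_points:
  assumes "x \<in> {0..<1} \<union> {\<alpha>..<\<beta>}" "y \<in> {0..<1} \<union> {\<alpha>..<\<beta>}" "x \<noteq> y"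
  shows "\<exists>l\<in>\<Lambda>. exp_freq (l - m) x \<noteq> exp_freq (l - m) y"
proof (rule ccontr)
  assume *: "\<not> ?thesis"
  define c :: "real \<Rightarrow> complex" where "c = (\<lambda>t. if t = x then 1 else -1)"
  have "c x = 0"
  proof (rule shifted_relation_trivial)
    show "(\<Sum>t\<in>{x, y}. c t * exp_freq (l - m) t) = 0" if "l \<in> \<Lambda>" for l
    proof -
      have "exp_freq (l - m) x = exp_freq (l - m) y" using * that by blast
      then show ?thesis using \<open>x \<noteq> y\<close> by (simp add: c_def)
    qed
  qed (use assms in auto)
  then show False by (simp add: c_def)
qed

text \<open>Three coefficients annihilating the vectors (1, 1, 1) and (w1, w2, w3) are provided by the cross
  product of these vectors, unless they are parallel; then all three values coincide and (1, -1, 0)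
  does.\<close>
lemma not_two_values_at_three_points:
  assumes pts: "{x1, x2, x3} \<subseteq> {0..<1} \<union> {\<alpha>..<\<beta>}" "x1 \<noteq> x2" "x1 \<noteq> x3" "x2 \<noteq> x3"
  shows "\<exists>l\<in>\<Lambda>. \<not> (exp_freq (l - m) x1 = 1 \<and> exp_freq (l - m) x2 = 1 \<and> exp_freq (l - m) x3 = 1) \<and>
    \<not> (exp_freq (l - m) x1 = w1 \<and> exp_freq (l - m) x2 = w2 \<and> exp_freq (l - m) x3 = w3)"
proof (rule ccontr)
  assume "\<not> ?thesis"
  then have vals: "exp_freq (l - m) x1 = 1 \<and> exp_freq (l - m) x2 = 1 \<and> exp_freq (l - m) x3 = 1 \<or>
    exp_freq (l - m) x1 = w1 \<and> exp_freq (l - m) x2 = w2 \<and> exp_freq (l - m) x3 = w3" if "l \<in> \<Lambda>" for l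
    using that by blast
  have triv: "c1 = 0 \<and> c2 = 0 \<and> c3 = 0" if "c1 + c2 + c3 = 0" "c1 * w1 + c2 * w2 + c3 * w3 = 0" for c1 c2 c3
  proof -
    define c where "c = (\<lambda>t. if t = x1 then c1 else if t = x2 then c2 else c3)"
    have c: "c x1 = c1" "c x2 = c2" "c x3 = c3" using pts by (auto simp: c_def)
    have "(\<Sum>x\<in>{x1, x2, x3}. c x * exp_freq (l - m) x) = 0" if "l \<in> \<Lambda>" for l
    proof -
      have "(\<Sum>x\<in>{x1, x2, x3}. c x * exp_freq (l - m) x) =
          c1 * exp_freq (l - m) x1 + c2 * exp_freq (l - m) x2 + c3 * exp_freq (l - m) x3"
        using pts(2-4) by (simp add: c add.assoc)
      also have "\<dots> = 0"
        using vals[OF that]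
      proof
        assume "exp_freq (l - m) x1 = 1 \<and> exp_freq (l - m) x2 = 1 \<and> exp_freq (l - m) x3 = 1"
        then show ?thesis using \<open>c1 + c2 + c3 = 0\<close> by simp
      next
        assume "exp_freq (l - m) x1 = w1 \<and> exp_freq (l - m) x2 = w2 \<and> exp_freq (l - m) x3 = w3"
        then show ?thesis using \<open>c1 * w1 + c2 * w2 + c3 * w3 = 0\<close> by simp
      qed
      finally show ?thesis .
    qed
    then have "c y = 0" if "y \<in> {x1, x2, x3}" for y
      using shifted_relation_trivial[of "{x1, x2, x3}" c m y] pts(1) that by blast
    then show ?thesis
      using c by (metis insertCI)
  qed
  have "w2 - w3 = 0 \<and> w3 - w1 = 0 \<and> w1 - w2 = 0"
    by (rule triv) (simp_all add: algebra_simps)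
  then have "w1 - w2 = 0" by (elim conjE)
  then have "w1 = w2" by simp
  then show False
    using triv[of 1 "-1" 0] by simp
qed

lemma no_common_period:
  assumes "x \<in> {0..<1} \<union> {\<alpha>..<\<beta>}" "y \<in> {0..<1} \<union> {\<alpha>..<\<beta>}" "x \<noteq> y"
  shows "\<exists>l\<in>\<Lambda>. exp_freq (l - m) (y - x) \<noteq> 1"
proof -
  obtain l where l: "l \<in> \<Lambda>" "exp_freq (l - m) x \<noteq> exp_freq (l - m) y"
    using not_equal_at_two_points[OF assms] by blast
  moreover have "exp_freq (l - m) y = exp_freq (l - m) (y - x) * exp_freq (l - m) x"
    by (simp flip: exp_freq_add_right)
  ultimately show ?thesis by force
qed

text \<open>The fractional part of \<alpha> lies in the first interval and differs from \<alpha> by an integer, which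
  would be a common period.\<close>
lemma spectrum_not_integral: "\<exists>l\<in>\<Lambda>. exp_freq (l - m) 1 \<noteq> 1"
proof -
  have "frac \<alpha> < 1" "frac \<alpha> \<ge> 0" by (auto simp: frac_lt_1)
  then obtain l where l: "l \<in> \<Lambda>" "exp_freq (l - m) (\<alpha> - frac \<alpha>) \<noteq> 1"
    using no_common_period[of "frac \<alpha>" \<alpha> m] \<alpha>\<beta> by auto
  then have "(l - m) * of_int \<lfloor>\<alpha>\<rfloor> \<notin> \<int>"
    by (simp add: frac_def exp_freq_eq_1_iff)
  then have "(l - m) * 1 \<notin> \<int>"
    using Ints_mult[OF _ Ints_of_int[of "\<lfloor>\<alpha>\<rfloor>"]] by auto
  then show ?thesis using l(1) by (auto simp: exp_freq_eq_1_iff)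
qed

text \<open>The common periods form a group D containing L. If \<beta> / L is not an integer, then the residue of \<beta>
  modulo L, or its negative, yields a period d' with 0 < d' \<le> L / 2. As the interval lengths add up
  to L, one of them exceeds d', and then two points of that interval differ by d', or both are equal
  to d' = 1, and then 0 and \<alpha> differ by a period.\<close>
lemma common_periods_imp_quotient_integer:
  assumes per: "\<And>l. l \<in> \<Lambda> \<Longrightarrow> exp_freq (l - m) \<beta> = 1" "\<And>l. l \<in> \<Lambda> \<Longrightarrow> exp_freq (l - m) (\<alpha> - 1) = 1"
  shows "\<beta> / (1 + \<beta> - \<alpha>) \<in> \<int>"
proof (rule ccontr)
  define L where "L = 1 + \<beta> - \<alpha>"
  assume "\<beta> / (1 + \<beta> - \<alpha>) \<notin> \<int>"
  then have nonint: "\<beta> / L \<notin> \<int>" by (simp add: L_def)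
  define D where "D = {d. \<forall>l\<in>\<Lambda>. (l - m) * d \<in> \<int>}"
  have Ddiff: "x - y \<in> D" if "x \<in> D" "y \<in> D" for x y
    using that unfolding D_def by (auto simp: right_diff_distrib)
  have Dint: "of_int n * x \<in> D" if "x \<in> D" for x n
    using that unfolding D_def by (auto simp: mult.left_commute)
  have "\<beta> \<in> D" and gap: "\<alpha> - 1 \<in> D"
    using per by (auto simp: D_def exp_freq_eq_1_iff)
  then have "L \<in> D"
    using Ddiff[of \<beta> "\<alpha> - 1"] by (simp add: L_def algebra_simps)
  have noD: "y - x \<notin> D" if "x \<in> {0..<1} \<union> {\<alpha>..<\<beta>}" "y \<in> {0..<1} \<union> {\<alpha>..<\<beta>}" "x \<noteq> y" for x y
    using no_common_period[OF that, of m] unfolding D_def exp_freq_eq_1_iff by blast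
  have L: "L > 1" using \<alpha>\<beta> by (simp add: L_def)
  define d where "d = frac (\<beta> / L) * L"
  have "d = \<beta> - of_int \<lfloor>\<beta> / L\<rfloor> * L"
    using L by (simp add: d_def frac_def left_diff_distrib)
  then have "d \<in> D" using Ddiff Dint \<open>\<beta> \<in> D\<close> \<open>L \<in> D\<close> by simp
  have d: "0 < d" "d < L"
    using nonint L frac_lt_1[of "\<beta> / L"] by (auto simp: d_def frac_gt_0_iff)
  define d' where "d' = min d (L - d)"
  have d': "0 < d'" "d' \<le> L / 2" using d by (auto simp: d'_def min_def)
  have d'D: "d' \<in> D" using \<open>d \<in> D\<close> Ddiff[OF \<open>L \<in> D\<close> \<open>d \<in> D\<close>] by (simp add: d'_def min_def)
  have "d' = 1 \<and> \<beta> - \<alpha> = 1" if "\<not> d' < 1" "\<not> d' < \<beta> - \<alpha>"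
  proof
    have "2 * d' \<le> 1 + (\<beta> - \<alpha>)" using d'(2) by (simp add: L_def)
    then show "d' = 1" "\<beta> - \<alpha> = 1" using that by simp_all
  qed
  then consider "d' < 1" | "d' < \<beta> - \<alpha>" | "d' = 1" "\<beta> - \<alpha> = 1"
    by blast
  then show False
  proof cases
    case 1 then show False using noD[of 0 d'] d' d'D by simp
  next
    case 2 then show False using noD[of \<alpha> "\<alpha> + d'"] d' d'D \<alpha>\<beta> by simp
  next
    case 3
    then have "\<alpha> - 0 \<in> D"
      using Ddiff[OF gap Dint[OF d'D, of "-1"]] by simp
    then show False using noD[of 0 \<alpha>] \<alpha>\<beta> by simp
  qed
qed

text \<open>The set D consists of the common periods of the group H of those \<delta> for which \<delta>, \<delta>\<alpha> and \<delta>\<beta>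
  are integers. An exponential with frequency in H is 1 on D, and one with frequency in the coset of
  k - m agrees on D with the exponential of k - m. So D contains no three points of the two intervals.
  This leaves no room for a fractional part of \<alpha> or \<beta>, nor for the point \<alpha> + 1.\<close>
lemma two_cosets_imp_integer:
  assumes k: "\<And>l. l \<in> \<Lambda> \<Longrightarrow> 
      exp_freq (l - m) 1 = 1 \<and> exp_freq (l - m) \<beta> = 1 \<and> exp_freq (l - m) \<alpha> = 1 \<or>
      exp_freq (l - k) 1 = 1 \<and> exp_freq (l - k) \<beta> = 1 \<and> exp_freq (l - k) \<alpha> = 1"
  shows "\<alpha> \<in> \<int> \<and> \<beta> = \<alpha> + 1"
proof -
  define D where "D = {d. \<forall>\<delta>. \<delta> \<in> \<int> \<longrightarrow> \<delta> * \<alpha> \<in> \<int> \<longrightarrow> \<delta> * \<beta> \<in> \<int> \<longrightarrow> \<delta> * d \<in> \<int>}"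
  have D1: "exp_freq \<delta> x = 1" 
    if "x \<in> D" "exp_freq \<delta> 1 = 1 \<and> exp_freq \<delta> \<beta> = 1 \<and> exp_freq \<delta> \<alpha> = 1" for \<delta> x
    using that by (simp add: D_def exp_freq_eq_1_iff)
  have quot: "exp_freq (l - m) x = exp_freq (l - k) x * exp_freq (k - m) x" for l x
    by (simp flip: exp_freq_add_left)
  have no3: False if pts: "{x1, x2, x3} \<subseteq> {0..<1} \<union> {\<alpha>..<\<beta>}" "x1 \<noteq> x2" "x1 \<noteq> x3" "x2 \<noteq> x3"
    and xD: "x1 \<in> D" "x2 \<in> D" "x3 \<in> D" for x1 x2 x3
  proof -
    obtain l where l: "l \<in> \<Lambda>" "\<not> (exp_freq (l - m) x1 = 1 \<and> exp_freq (l - m) x2 = 1 \<and> exp_freq (l - m) x3 = 1)"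
      "\<not> (exp_freq (l - m) x1 = exp_freq (k - m) x1 \<and> exp_freq (l - m) x2 = exp_freq (k - m) x2 \<and> 
         exp_freq (l - m) x3 = exp_freq (k - m) x3)"
      using not_two_values_at_three_points[OF pts] by blast
    from k[OF l(1)] show False
    proof
      assume "exp_freq (l - m) 1 = 1 \<and> exp_freq (l - m) \<beta> = 1 \<and> exp_freq (l - m) \<alpha> = 1"
      then show False using l(2) D1 xD by blast
    next
      assume "exp_freq (l - k) 1 = 1 \<and> exp_freq (l - k) \<beta> = 1 \<and> exp_freq (l - k) \<alpha> = 1"
      then have "exp_freq (l - k) x = 1" if "x \<in> D" for x using D1 that by blast
      then show False using l(3) xD by (simp add: quot[of l])
    qed
  qed
  have D: "0 \<in> D" "1 \<in> D" "\<alpha> \<in> D" "\<beta> \<in> D" by (auto simp: D_def)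
  have Dadd: "x + y \<in> D" if "x \<in> D" "y \<in> D" for x y
    using that unfolding D_def by (auto simp: distrib_left)
  have Dfrac: "frac x \<in> D" if "x \<in> D" for x
    using that unfolding D_def by (auto simp: frac_def right_diff_distrib)
  have D_int: "x \<in> \<int>" if "x \<in> D" for x
  proof (rule ccontr)
    assume "x \<notin> \<int>"
    then have "0 < frac x" "frac x < 1" by (auto simp: frac_lt_1 frac_gt_0_iff)
    then show False using no3[of 0 "frac x" \<alpha>] D Dfrac[OF that] \<alpha>\<beta> by simp
  qed
  then have Z: "\<alpha> \<in> \<int>" "\<beta> \<in> \<int>" using D by auto
  have "\<beta> = \<alpha> + 1"
  proof (rule ccontr)
    assume "\<beta> \<noteq> \<alpha> + 1"
    moreover obtain i j where ij: "\<alpha> = of_int i" "\<beta> = of_int j"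
      using Z by (auto elim!: Ints_cases)
    ultimately have "i + 1 < j" using \<alpha>\<beta> by (metis add.commute linorder_neqE of_int_1 of_int_add of_int_less_iff order_less_asym zless_imp_add1_zle order_le_less)
    then have "\<alpha> + 1 < \<beta>" unfolding ij by linarith
    then show False using no3[of 0 \<alpha> "\<alpha> + 1"] D Dadd \<alpha>\<beta> by simp
  qed
  with Z show ?thesis by blast
qed

lemma spectrum_shape:
  assumes m: "m \<in> \<Lambda>"
  shows "(\<forall>l\<in>\<Lambda>. exp_freq (l - m) 1 = 1) \<or>
    (\<forall>l\<in>\<Lambda>. exp_freq (l - m) \<beta> = 1 \<and> exp_freq (l - m) \<alpha> = exp_freq (l - m) 1) \<or>
    (\<exists>k\<in>\<Lambda>. \<forall>l\<in>\<Lambda>. exp_freq (l - m) 1 = 1 \<and> exp_freq (l - m) \<beta> = 1 \<and> exp_freq (l - m) \<alpha> = 1 \<or>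
      exp_freq (l - m) 1 = exp_freq (k - m) 1 \<and> exp_freq (l - m) \<beta> = exp_freq (k - m) \<beta> \<and>
      exp_freq (l - m) \<alpha> = exp_freq (k - m) \<alpha>)"
proof (rule unit_triples_cases[where a = "\<lambda>l. exp_freq (l - m) 1" and y = "\<lambda>l. exp_freq (l - m) \<beta>"
      and z = "\<lambda>l. exp_freq (l - m) \<alpha>" and p = m])
  fix l k assume lk: "l \<in> \<Lambda>" "k \<in> \<Lambda>"
  have "exp_freq (l - m) x = exp_freq (l - k) x * exp_freq (k - m) x" for x
    by (simp flip: exp_freq_add_left)
  then have quot: "exp_freq (l - m) x / exp_freq (k - m) x = exp_freq (l - k) x" for x
    by simp
  have "exp_freq (l - k) 1 + exp_freq (l - k) \<beta> = 1 + exp_freq (l - k) \<alpha>"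
  proof (cases "l = k")
    case False
    then have "L2_inner (lebesgue_on \<Omega>) (exp_freq l) (exp_freq k) = 0"
      using basis lk by (simp add: L2_orthogonal_basis_def)
    then show ?thesis
      using \<alpha>\<beta> False unfolding \<Omega>_def by (subst (asm) L2_inner_exp_freq_two_intervals) auto
  qed auto
  then show "exp_freq (l - m) 1 / exp_freq (k - m) 1 + exp_freq (l - m) \<beta> / exp_freq (k - m) \<beta> =
       1 + exp_freq (l - m) \<alpha> / exp_freq (k - m) \<alpha>"
    unfolding quot .
qed (use m in auto)

lemma basis_two_intervals_imp:
  "\<beta> / (1 + \<beta> - \<alpha>) \<in> \<int> \<or> (\<alpha> \<in> \<int> \<and> \<beta> = \<alpha> + 1)"
proof -
  obtain m where m: "m \<in> \<Lambda>" using spectrum_nonempty by blast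
  have quot: "exp_freq (l - m) x = exp_freq (l - k) x * exp_freq (k - m) x" for l k x
    by (simp flip: exp_freq_add_left)
  from spectrum_shape[OF m] show ?thesis
  proof (elim disjE bexE)
    assume "\<forall>l\<in>\<Lambda>. exp_freq (l - m) 1 = 1"
    then show ?thesis using spectrum_not_integral by blast
  next
    assume *: "\<forall>l\<in>\<Lambda>. exp_freq (l - m) \<beta> = 1 \<and> exp_freq (l - m) \<alpha> = exp_freq (l - m) 1"
    have "exp_freq (l - m) (\<alpha> - 1) = 1" if "l \<in> \<Lambda>" for l
    proof -
      have "exp_freq (l - m) \<alpha> = exp_freq (l - m) (\<alpha> - 1) * exp_freq (l - m) 1"
        by (simp flip: exp_freq_add_right)
      then show ?thesis using * that by simp
    qed
    then have "\<beta> / (1 + \<beta> - \<alpha>) \<in> \<int>"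
      using * by (intro common_periods_imp_quotient_integer[of m]) auto
    then show ?thesis ..
  next
    fix k
    assume *: "\<forall>l\<in>\<Lambda>. exp_freq (l - m) 1 = 1 \<and> exp_freq (l - m) \<beta> = 1 \<and> exp_freq (l - m) \<alpha> = 1 \<or>
      exp_freq (l - m) 1 = exp_freq (k - m) 1 \<and> exp_freq (l - m) \<beta> = exp_freq (k - m) \<beta> \<and>
      exp_freq (l - m) \<alpha> = exp_freq (k - m) \<alpha>"
    have kshift: "exp_freq (l - k) x = 1" if "exp_freq (l - m) x = exp_freq (k - m) x" for l x
      using that quot[of l x k] by simp
    have "\<alpha> \<in> \<int> \<and> \<beta> = \<alpha> + 1"
    proof (rule two_cosets_imp_integer[of m k])
      fix l assume "l \<in> \<Lambda>"
      from bspec[OF * this]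
      show "exp_freq (l - m) 1 = 1 \<and> exp_freq (l - m) \<beta> = 1 \<and> exp_freq (l - m) \<alpha> = 1 \<or>
        exp_freq (l - k) 1 = 1 \<and> exp_freq (l - k) \<beta> = 1 \<and> exp_freq (l - k) \<alpha> = 1"
        by (elim disj_forward conj_forward) (auto intro: kshift)
    qed
    then show ?thesis ..
  qed
qed

end

section \<open>Exponential polynomials and density in the square-integrable functions on an interval\<close>

definition exp_poly :: "real set \<Rightarrow> (real \<Rightarrow> complex) \<Rightarrow> bool" where
  "exp_poly \<Lambda> p \<longleftrightarrow> (\<exists>F c. finite F \<and> F \<subseteq> \<Lambda> \<and> p = (\<lambda>x. \<Sum>i\<in>F. c i * exp_freq i x))"

lemma exp_poly_single: "i \<in> \<Lambda> \<Longrightarrow> exp_poly \<Lambda> (\<lambda>x. a * exp_freq i x)"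
  unfolding exp_poly_def by (intro exI[of _ "{i}"] exI[of _ "\<lambda>_. a"]) auto

lemma exp_poly_add:
  assumes "exp_poly \<Lambda> p" "exp_poly \<Lambda> q"
  shows "exp_poly \<Lambda> (\<lambda>x. p x + q x)"
proof -
  obtain F c where F: "finite F" "F \<subseteq> \<Lambda>" "p = (\<lambda>x. \<Sum>i\<in>F. c i * exp_freq i x)"
    using assms(1) by (auto simp: exp_poly_def)
  obtain G d where G: "finite G" "G \<subseteq> \<Lambda>" "q = (\<lambda>x. \<Sum>i\<in>G. d i * exp_freq i x)"
    using assms(2) by (auto simp: exp_poly_def)
  have "p x = (\<Sum>i\<in>F \<union> G. (if i \<in> F then c i else 0) * exp_freq i x)" for x
    unfolding F using F(1) G(1) by (intro sum.mono_neutral_cong_left) auto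
  moreover have "q x = (\<Sum>i\<in>F \<union> G. (if i \<in> G then d i else 0) * exp_freq i x)" for x
    unfolding G using F(1) G(1) by (intro sum.mono_neutral_cong_left) auto
  ultimately have "(\<lambda>x. p x + q x) = (\<lambda>x. \<Sum>i\<in>F \<union> G. ((if i \<in> F then c i else 0) + (if i \<in> G then d i else 0)) * exp_freq i x)"
    by (simp add: distrib_right sum.distrib)
  then show ?thesis
    unfolding exp_poly_def using F G
    by (intro exI[of _ "F \<union> G"] exI[of _ "\<lambda>i. (if i \<in> F then c i else 0) + (if i \<in> G then d i else 0)"]) auto
qed

lemma exp_poly_sum:
  assumes "\<And>j. j \<in> J \<Longrightarrow> exp_poly \<Lambda> (p j)"
  shows "exp_poly \<Lambda> (\<lambda>x. \<Sum>j\<in>J. p j x)"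
proof -
  have "exp_poly \<Lambda> (\<lambda>x. 0)"
    unfolding exp_poly_def by (intro exI[of _ "{}"]) auto
  then show ?thesis
    using assms by (induction J rule: infinite_finite_induct) (auto intro: exp_poly_add)
qed

lemma exp_poly_mult:
  assumes "exp_poly \<Lambda> p" "exp_poly \<Lambda> q" and closed: "\<And>i j. i \<in> \<Lambda> \<Longrightarrow> j \<in> \<Lambda> \<Longrightarrow> i + j \<in> \<Lambda>'"
  shows "exp_poly \<Lambda>' (\<lambda>x. p x * q x)"
proof -
  obtain F c where F: "F \<subseteq> \<Lambda>" "p = (\<lambda>x. \<Sum>i\<in>F. c i * exp_freq i x)"
    using assms(1) by (auto simp: exp_poly_def)
  obtain G d where G: "G \<subseteq> \<Lambda>" "q = (\<lambda>x. \<Sum>i\<in>G. d i * exp_freq i x)"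
    using assms(2) by (auto simp: exp_poly_def)
  have eq: "(\<lambda>x. p x * q x) = (\<lambda>x. \<Sum>i\<in>F. \<Sum>j\<in>G. (c i * d j) * exp_freq (i + j) x)"
    unfolding F G by (simp add: sum_product exp_freq_add_left mult_ac)
  show ?thesis
    unfolding eq using F(1) G(1) closed by (intro exp_poly_sum exp_poly_single) blast
qed

lemma exp_poly_bounded_measurable:
  assumes "exp_poly \<Lambda> p"
  shows "p \<in> borel_measurable (lebesgue_on S)" "\<exists>B. \<forall>x. cmod (p x) \<le> B"
proof -
  obtain F c where F: "p = (\<lambda>x. \<Sum>i\<in>F. c i * exp_freq i x)"
    using assms(1) by (auto simp: exp_poly_def)
  show "p \<in> borel_measurable (lebesgue_on S)" unfolding F by measurable
  have "cmod (p x) \<le> (\<Sum>i\<in>F. cmod (c i))" for x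
    unfolding F by (rule order_trans[OF norm_sum]) (simp add: norm_mult)
  then show "\<exists>B. \<forall>x. cmod (p x) \<le> B" by blast
qed

lemma exp_poly_L2:
  assumes "exp_poly \<Lambda> p" "S \<in> lmeasurable"
  shows "p \<in> L2_space (lebesgue_on S)"
proof -
  obtain B where "cmod (p x) \<le> B" for x using exp_poly_bounded_measurable(2)[OF assms(1)] by blast
  then show ?thesis
    by (intro L2_space_bounded finite_measure_lebesgue_on assms(2) exp_poly_bounded_measurable(1)[OF assms(1)])
qed

text \<open>The frequencies whose exponentials have period L.\<close>
definition harmonics :: "real \<Rightarrow> real set" where
  "harmonics L = range (\<lambda>n::int. of_int n / L)"

lemma harmonics_add: "i \<in> harmonics L \<Longrightarrow> j \<in> harmonics L \<Longrightarrow> i + j \<in> harmonics L"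
  unfolding harmonics_def by (auto simp flip: add_divide_distrib of_int_add)

lemma in_harmonics: "of_int n / L \<in> harmonics L"
  by (auto simp: harmonics_def)

text \<open>On the unit circle the coordinate functions are combinations of z and its inverse, and products of
  harmonics are harmonics, so polynomials on the circle pull back to trigonometric polynomials.\<close>
lemma exp_poly_real_polynomial:
  fixes g :: "complex \<Rightarrow> real"
  assumes "real_polynomial_function g"
  shows "exp_poly (harmonics L) (\<lambda>x. of_real (g (exp_freq (1 / L) x)))"
  using assms
proof (induction g rule: real_polynomial_function.induct)
  case (linear g)
  have g: "g z = Re z * g 1 + Im z * g \<i>" for z
  proof -
    interpret bounded_linear g by fact
    have "g z = g (Re z *\<^sub>R 1 + Im z *\<^sub>R \<i>)"
      by (rule arg_cong[of _ _ g]) (simp add: complex_eq_iff)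
    then show ?thesis by (simp add: add scaleR)
  qed
  define a where "a = Complex (g 1 / 2) (- g \<i> / 2)"
  have "complex_of_real (g z) = a * z + cnj a * cnj z" for z
  proof -
    have "a * z + cnj (a * z) = complex_of_real (2 * Re (a * z))"
      by (rule complex_add_cnj)
    also have "2 * Re (a * z) = Re z * g 1 + Im z * g \<i>"
      by (simp add: a_def)
    finally show ?thesis by (simp only: g[of z] complex_cnj_mult)
  qed
  then have eq: "(\<lambda>x. complex_of_real (g (exp_freq (1 / L) x))) = 
    (\<lambda>x. a * exp_freq (1 / L) x + cnj a * exp_freq (- (1 / L)) x)"
    by (simp add: exp_freq_minus)
  show ?case
    unfolding eq using in_harmonics[of 1 L] in_harmonics[of "-1" L] 
    by (intro exp_poly_add exp_poly_single) auto
next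
  case (const c)
  show ?case
    using exp_poly_single[OF in_harmonics[of 0 L], of "of_real c"] by simp
next
  case (add f g)
  then show ?case by (simp add: exp_poly_add)
next
  case (mult f g)
  then show ?case by (simp add: exp_poly_mult[OF _ _ harmonics_add])
qed

lemma exp_freq_eq_on_period:
  assumes "0 < L" "x \<in> {0..L}" "y \<in> {0..L}" "exp_freq (1 / L) x = exp_freq (1 / L) y"
  shows "x = y \<or> {x, y} = {0, L}"
proof -
  have "exp_freq (1 / L) (x - y) * exp_freq (1 / L) y = exp_freq (1 / L) y"
    using assms(4) by (simp flip: exp_freq_add_right)
  then have "(x - y) / L \<in> \<int>" by (simp add: exp_freq_eq_1_iff)
  then obtain n :: int where "(x - y) / L = of_int n" by (auto elim: Ints_cases)
  then have n: "x - y = of_int n * L" using assms(1) by (simp add: field_simps)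
  moreover have "\<bar>x - y\<bar> \<le> 1 * L" using assms by auto
  ultimately have "\<bar>of_int n\<bar> \<le> (1::real)" using assms(1) by (simp add: abs_mult)
  then have "n = 0 \<or> n = 1 \<or> n = -1" by linarith
  then show ?thesis using n assms(2,3) by auto
qed

text \<open>A continuous function with equal values at 0 and L factors through the circle, because the
  exponential map from the compact interval onto its image is a quotient map. The Stone-Weierstrass
  theorem applies to the factor.\<close>
lemma real_trigonometric_approximation:
  fixes G :: "real \<Rightarrow> real"
  assumes L: "0 < L" and G: "continuous_on {0..L} G" "G 0 = G L" and "e > 0"
  shows "\<exists>p. exp_poly (harmonics L) p \<and> (\<forall>x\<in>{0..L}. cmod (of_real (G x) - p x) < e)"
proof -
  let ?\<Phi> = "exp_freq (1 / L)"
  define h where "h = (\<lambda>z. G (inv_into {0..L} ?\<Phi> z))"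
  have h: "h (?\<Phi> x) = G x" if "x \<in> {0..L}" for x
  proof -
    have "inv_into {0..L} ?\<Phi> (?\<Phi> x) \<in> {0..L}" "?\<Phi> (inv_into {0..L} ?\<Phi> (?\<Phi> x)) = ?\<Phi> x"
      by (rule inv_into_into[OF imageI[OF that]], rule f_inv_into_f[OF imageI[OF that]])
    then have "inv_into {0..L} ?\<Phi> (?\<Phi> x) = x \<or> {inv_into {0..L} ?\<Phi> (?\<Phi> x), x} = {0, L}"
      by (intro exp_freq_eq_on_period L that)
    then show ?thesis unfolding h_def using G(2) by (auto simp: doubleton_eq_iff)
  qed
  have quot: "quotient_map (top_of_set {0..L}) (top_of_set (?\<Phi> ` {0..L})) ?\<Phi>"
    by (intro T1_Spaces.continuous_imp_quotient_map)
      (auto simp: continuous_map_in_subtopology continuous_on_exp_freq compact_space_subtopology Hausdorff_space_subtopology)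
  have "continuous_on {0..L} (h \<circ> ?\<Phi>)"
    by (rule continuous_on_eq[OF G(1)]) (simp add: h)
  then have "continuous_map (top_of_set {0..L}) euclidean (h \<circ> ?\<Phi>)"
    by (simp only: continuous_map_iff_continuous)
  from continuous_compose_quotient_map[OF quot this] have "continuous_on (?\<Phi> ` {0..L}) h"
    by (simp only: continuous_map_iff_continuous)
  moreover have "compact (?\<Phi> ` {0..L})"
    by (intro compact_continuous_image continuous_on_exp_freq) auto
  ultimately obtain g where g: "real_polynomial_function g" "\<And>z. z \<in> ?\<Phi> ` {0..L} \<Longrightarrow> \<bar>h z - g z\<bar> < e"
    using Stone_Weierstrass_real_polynomial_function[of "?\<Phi> ` {0..L}" h e] \<open>e > 0\<close> by blast
  have "cmod (of_real (G x) - of_real (g (?\<Phi> x))) < e" if "x \<in> {0..L}" for x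
    using g(2)[of "?\<Phi> x"] h[OF that] that by (simp flip: of_real_diff)
  then show ?thesis
    using exp_poly_real_polynomial[OF g(1), of L] by blast
qed

lemma trigonometric_approximation:
  fixes G :: "real \<Rightarrow> complex"
  assumes L: "0 < L" and G: "continuous_on {0..L} G" "G 0 = G L" and "e > 0"
  shows "\<exists>p. exp_poly (harmonics L) p \<and> (\<forall>x\<in>{0..L}. cmod (G x - p x) < e)"
proof -
  have cont: "continuous_on {0..L} (\<lambda>x. Re (G x))" "continuous_on {0..L} (\<lambda>x. Im (G x))"
    using G(1) by (auto intro: continuous_intros)
  obtain p where p: "exp_poly (harmonics L) p" "\<And>x. x \<in> {0..L} \<Longrightarrow> cmod (of_real (Re (G x)) - p x) < e / 2"
    using real_trigonometric_approximation[of L "\<lambda>x. Re (G x)" "e / 2"] assms cont by auto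
  obtain q where q: "exp_poly (harmonics L) q" "\<And>x. x \<in> {0..L} \<Longrightarrow> cmod (of_real (Im (G x)) - q x) < e / 2"
    using real_trigonometric_approximation[of L "\<lambda>x. Im (G x)" "e / 2"] assms cont by auto
  have "exp_poly (harmonics L) (\<lambda>x. \<i> * exp_freq 0 x)"
    using exp_poly_single[OF in_harmonics[of 0 L]] by simp
  from exp_poly_mult[OF this q(1) harmonics_add] have "exp_poly (harmonics L) (\<lambda>x. p x + \<i> * q x)"
    by (intro exp_poly_add p(1)) auto
  moreover have "cmod (G x - (p x + \<i> * q x)) < e" if "x \<in> {0..L}" for x
  proof -
    have "G x - (p x + \<i> * q x) = (of_real (Re (G x)) - p x) + \<i> * (of_real (Im (G x)) - q x)"
      by (simp add: complex_eq_iff)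
    also have "cmod \<dots> \<le> cmod (of_real (Re (G x)) - p x) + cmod (\<i> * (of_real (Im (G x)) - q x))"
      by (rule norm_triangle_ineq)
    also have "\<dots> < e" using p(2)[OF that] q(2)[OF that] by (simp add: norm_mult)
    finally show ?thesis .
  qed
  ultimately show ?thesis by blast
qed

text \<open>A bounded measurable function is an almost everywhere limit of continuous functions. These are
  made bounded by \<open>clip\<close>, which retracts the plane radially to a disc, and made zero at both end
  points by \<open>cut\<close>, which tends to 1 in the interior. Dominated convergence turns this into
  approximation in the mean, and the uniform approximation of periodic continuous functions does the
  rest.\<close>
lemma L2_approx_bounded:
  assumes L: "0 < L" and f: "f \<in> borel_measurable (lebesgue_on {0..L})"
    and bnd: "\<And>x. cmod (f x) \<le> B" and "e > 0"
  shows "\<exists>p. exp_poly (harmonics L) p \<and> (LINT x|lebesgue_on {0..L}. (cmod (f x - p x))\<^sup>2) < e"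
proof -
  let ?M = "lebesgue_on {0..L}"
  have fin: "finite_measure ?M" by (intro finite_measure_lebesgue_on) auto
  have B: "0 \<le> B" using order_trans[OF norm_ge_zero bnd[of 0]] .
  define C where "C = B + 1"
  have C: "C > 0" and bnd': "\<And>x. cmod (f x) \<le> C" using B bnd by (auto simp: C_def intro: order_trans[OF bnd])
  have "f measurable_on {0..L}"
    using f by (simp add: measurable_on_iff_borel_measurable)
  then obtain N g where N: "negligible N" and g: "\<And>n. continuous_on UNIV (g n)"
    and lim: "\<And>x. x \<notin> N \<Longrightarrow> (\<lambda>n. g n x) \<longlonglongrightarrow> (if x \<in> {0..L} then f x else 0)"
    by (auto simp: measurable_on_def)
  define clip where "clip = (\<lambda>z::complex. of_real (C / max C (cmod z)) * z)"
  define cut where "cut = (\<lambda>(n::nat) x. min 1 (real n * (x * (L - x))))"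
  define G where "G = (\<lambda>n x. of_real (cut n x) * clip (g n x))"
  have clip_cont: "continuous_on UNIV clip"
    unfolding clip_def using C by (intro continuous_intros) (auto simp: max_def)
  have clip_bound: "cmod (clip z) \<le> C" for z
  proof -
    have "cmod (clip z) = C * cmod z / max C (cmod z)"
      using C by (simp add: clip_def norm_mult norm_divide max_def)
    also have "\<dots> \<le> C"
      using C by (simp add: field_simps max_def)
    finally show ?thesis .
  qed
  have clip_id: "clip z = z" if "cmod z \<le> C" for z
    using that C by (simp add: clip_def max_def)
  have G_cont: "continuous_on S (G n)" for S n
  proof -
    have "continuous_on UNIV (\<lambda>x. clip (g n x))"
      using continuous_on_compose2[OF clip_cont g] by auto
    then have "continuous_on S (\<lambda>x. clip (g n x))" by (rule continuous_on_subset) auto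
    then show ?thesis
      unfolding G_def cut_def by (intro continuous_intros)
  qed
  have cut: "\<bar>cut n x\<bar> \<le> 1" if "x \<in> {0..L}" for n x
    using that by (auto simp: cut_def min_def)
  have G_bound: "cmod (G n x) \<le> C" if "x \<in> {0..L}" for n x
    using mult_mono[OF cut[OF that] clip_bound[of "g n x"]] by (simp add: G_def norm_mult)
  have G_meas: "G n \<in> borel_measurable ?M" for n
    by (intro continuous_imp_measurable_on_sets_lebesgue G_cont) auto
  have G_lim: "(\<lambda>n. G n x) \<longlonglongrightarrow> f x" if "x \<in> {0<..<L}" "x \<notin> N" for x
  proof -
    have "(\<lambda>n. clip (g n x)) \<longlonglongrightarrow> clip (f x)"
      using lim[OF that(2)] that(1) clip_cont by (intro isCont_tendsto_compose[of _ clip]) (auto simp: continuous_on_eq_continuous_at)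
    moreover have "(\<lambda>n. cut n x) \<longlonglongrightarrow> 1"
    proof (rule tendsto_eventually)
      have pos: "x * (L - x) > 0" using that by simp
      obtain k :: nat where k: "1 < real k * (x * (L - x))" using reals_Archimedean3[OF pos] by blast
      have "cut n x = 1" if "n \<ge> k" for n
      proof -
        have "real k * (x * (L - x)) \<le> real n * (x * (L - x))"
          using that pos by (intro mult_right_mono) auto
        then show ?thesis using k by (simp add: cut_def)
      qed
      then show "\<forall>\<^sub>F n in sequentially. cut n x = 1"
        by (auto simp: eventually_sequentially)
    qed
    ultimately have "(\<lambda>n. G n x) \<longlonglongrightarrow> of_real 1 * clip (f x)"
      unfolding G_def by (intro tendsto_intros)
    then show ?thesis using clip_id[OF bnd'] by simp
  qed
  have "(\<lambda>n. LINT x|?M. (cmod (f x - G n x))\<^sup>2) \<longlonglongrightarrow> (LINT x|?M. 0)"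
  proof (rule integral_dominated_convergence[where w = "\<lambda>_. (2 * C)\<^sup>2"])
    have [measurable]: "f \<in> borel_measurable ?M" "G n \<in> borel_measurable ?M" for n using f G_meas by auto
    show "(\<lambda>x. (cmod (f x - G n x))\<^sup>2) \<in> borel_measurable ?M" for n by measurable
    have "negligible (N \<union> {0, L})" using N by (intro negligible_Un) auto
    then have "AE x in lebesgue. x \<notin> N \<union> {0, L}"
      by (intro AE_not_in) (simp add: negligible_iff_null_sets)
    then have "AE x in lebesgue. x \<in> {0..L} \<longrightarrow> (\<lambda>n. (cmod (f x - G n x))\<^sup>2) \<longlonglongrightarrow> 0"
    proof eventually_elim
      case (elim x)
      show ?case
      proof
        assume "x \<in> {0..L}"
        then have "(\<lambda>n. (cmod (f x - G n x))\<^sup>2) \<longlonglongrightarrow> (cmod (f x - f x))\<^sup>2"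
          using elim by (intro tendsto_intros G_lim) auto
        then show "(\<lambda>n. (cmod (f x - G n x))\<^sup>2) \<longlonglongrightarrow> 0" by simp
      qed
    qed
    then show "AE x in ?M. (\<lambda>n. (cmod (f x - G n x))\<^sup>2) \<longlonglongrightarrow> 0"
      by (subst AE_restrict_space_iff) auto
    show "AE x in ?M. norm ((cmod (f x - G n x))\<^sup>2) \<le> (2 * C)\<^sup>2" for n
    proof (rule AE_I2)
      fix x assume "x \<in> space ?M"
      then have "cmod (f x - G n x) \<le> C + C"
        by (intro order_trans[OF norm_triangle_ineq4] add_mono bnd' G_bound) auto
      then show "norm ((cmod (f x - G n x))\<^sup>2) \<le> (2 * C)\<^sup>2"
        using power_mono[of "cmod (f x - G n x)" "2 * C" 2] by simp
    qed
  qed auto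
  then have "\<forall>\<^sub>F n in sequentially. (LINT x|?M. (cmod (f x - G n x))\<^sup>2) < e / 4"
    using \<open>e > 0\<close> by (intro order_tendstoD(2)) auto
  then obtain n where n: "(LINT x|?M. (cmod (f x - G n x))\<^sup>2) < e / 4"
    by (auto simp: eventually_sequentially)
  \<comment> \<open>A uniform error d contributes at most d squared times L to the mean square error.\<close>
  define d where "d = sqrt (e / (4 * L))"
  have d: "d > 0" "d\<^sup>2 * L = e / 4" using \<open>e > 0\<close> L by (auto simp: d_def)
  have "G n 0 = G n L" by (simp add: G_def cut_def)
  then obtain p where p: "exp_poly (harmonics L) p" "\<And>x. x \<in> {0..L} \<Longrightarrow> cmod (G n x - p x) < d"
    using trigonometric_approximation[OF L G_cont _ d(1)] by blast
  have L2: "f \<in> L2_space ?M" "G n \<in> L2_space ?M" "p \<in> L2_space ?M"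
  proof -
    show "f \<in> L2_space ?M" by (rule L2_space_bounded[OF fin f bnd])
    show "G n \<in> L2_space ?M" by (rule L2_space_bounded[OF fin G_meas]) (rule G_bound, simp)
    show "p \<in> L2_space ?M" by (rule exp_poly_L2[OF p(1)]) simp
  qed
  have "(LINT x|?M. (cmod (G n x - p x))\<^sup>2) \<le> (LINT x|?M. d\<^sup>2)"
  proof (rule integral_mono)
    show "integrable ?M (\<lambda>x. (cmod (G n x - p x))\<^sup>2)"
      using L2_space_diff[OF L2(2,3)] by (simp add: L2_space_def)
    show "(cmod (G n x - p x))\<^sup>2 \<le> d\<^sup>2" if "x \<in> space ?M" for x
      using p(2)[of x] that by (intro power_mono) auto
  qed simp
  also have "\<dots> = e / 4" using L d(2) by (simp add: measure_restrict_space mult.commute)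
  finally have "(LINT x|?M. (cmod (f x - p x))\<^sup>2) < e"
    using L2_norm_diff_power2_le[OF L2] n by simp
  then show ?thesis using p(1) by blast
qed

text \<open>By dominated convergence, replacing the large values by 0 reduces this to bounded functions.\<close>
theorem trigonometric_polynomials_dense_L2:
  assumes L: "0 < L" and f: "f \<in> L2_space (lebesgue_on {0..L})" and "e > 0"
  shows "\<exists>p. exp_poly (harmonics L) p \<and> (LINT x|lebesgue_on {0..L}. (cmod (f x - p x))\<^sup>2) < e"
proof -
  let ?M = "lebesgue_on {0..L}"
  have [measurable]: "f \<in> borel_measurable ?M" and int: "integrable ?M (\<lambda>x. (cmod (f x))\<^sup>2)" 
    using f by (auto simp: L2_space_def)
  define T where "T = (\<lambda>(n::nat) x. if cmod (f x) \<le> real n then f x else 0)"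
  have T_meas [measurable]: "T n \<in> borel_measurable ?M" for n unfolding T_def by measurable
  have "(\<lambda>n. LINT x|?M. (cmod (f x - T n x))\<^sup>2) \<longlonglongrightarrow> (LINT x|?M. 0)"
  proof (rule integral_dominated_convergence[where w = "\<lambda>x. (cmod (f x))\<^sup>2"])
    show "AE x in ?M. (\<lambda>n. (cmod (f x - T n x))\<^sup>2) \<longlonglongrightarrow> 0"
    proof (rule AE_I2, rule tendsto_eventually)
      fix x
      obtain k where "cmod (f x) \<le> real k" using real_arch_simple by blast
      then have "(cmod (f x - T n x))\<^sup>2 = 0" if "n \<ge> k" for n
        using that by (auto simp: T_def)
      then show "\<forall>\<^sub>F n in sequentially. (cmod (f x - T n x))\<^sup>2 = 0"
        by (auto simp: eventually_sequentially)
    qed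
  qed (use int in \<open>auto simp: T_def\<close>)
  then have "\<forall>\<^sub>F n in sequentially. (LINT x|?M. (cmod (f x - T n x))\<^sup>2) < e / 4"
    using \<open>e > 0\<close> by (intro order_tendstoD(2)) auto
  then obtain n where n: "(LINT x|?M. (cmod (f x - T n x))\<^sup>2) < e / 4"
    by (auto simp: eventually_sequentially)
  have bnd: "cmod (T n x) \<le> real n" for x by (simp add: T_def)
  obtain p where p: "exp_poly (harmonics L) p" "(LINT x|?M. (cmod (T n x - p x))\<^sup>2) < e / 4"
    using L2_approx_bounded[OF L T_meas bnd, of "e / 4"] \<open>e > 0\<close> by auto
  have "T n \<in> L2_space ?M" 
    using bnd by (intro L2_space_bounded[of _ _ "real n"] finite_measure_lebesgue_on) auto
  moreover have "p \<in> L2_space ?M" by (intro exp_poly_L2[OF p(1)]) auto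
  ultimately have "(LINT x|?M. (cmod (f x - p x))\<^sup>2) < e"
    using L2_norm_diff_power2_le[of f ?M "T n" p] f n p(2) by simp
  then show ?thesis using p(1) by blast
qed

section \<open>Sufficiency\<close>

lemma exp_poly_period:
  assumes "exp_poly (harmonics L) p" "L \<noteq> 0"
  shows "p (x + of_int k * L) = p x"
proof -
  obtain F c where F: "F \<subseteq> harmonics L" "p = (\<lambda>x. \<Sum>i\<in>F. c i * exp_freq i x)"
    using assms(1) by (auto simp: exp_poly_def)
  have "exp_freq i (x + of_int k * L) = exp_freq i x" if "i \<in> F" for i
  proof -
    have "i \<in> harmonics L" using that F(1) by blast
    then obtain n :: int where "i = of_int n / L" by (auto simp: harmonics_def)
    then have "i * (of_int k * L) = of_int (n * k)" using assms(2) by simp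
    then have "exp_freq i (of_int k * L) = 1" by (simp only: exp_freq_eq_1_iff Ints_of_int)
    then show ?thesis by (simp add: exp_freq_add_right)
  qed
  then show ?thesis unfolding F by (intro sum.cong) auto
qed

lemma exp_poly_mono: "exp_poly \<Lambda> p \<Longrightarrow> \<Lambda> \<subseteq> \<Lambda>' \<Longrightarrow> exp_poly \<Lambda>' p"
  unfolding exp_poly_def by blast

lemma L2_space_lebesgue_on_iff:
  assumes "S \<in> sets lebesgue"
  shows "f \<in> L2_space (lebesgue_on S) \<longleftrightarrow> (\<lambda>x. indicator S x *\<^sub>R f x) \<in> L2_space lebesgue"
proof -
  have "(\<lambda>x. (cmod (indicator S x *\<^sub>R f x))\<^sup>2) = (\<lambda>x. indicator S x *\<^sub>R (cmod (f x))\<^sup>2)"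
    by (auto simp: indicator_def fun_eq_iff)
  then show ?thesis
    using assms by (simp add: L2_space_def borel_measurable_restrict_space_iff integrable_restrict_space)
qed

lemma L2_space_translate:
  assumes S: "S \<in> sets lebesgue" and T: "T \<in> sets lebesgue" and f: "f \<in> L2_space (lebesgue_on T)"
    and sub: "\<And>x::real. x \<in> S \<Longrightarrow> x + t \<in> T"
  shows "(\<lambda>x. f (x + t)) \<in> L2_space (lebesgue_on S)"
proof -
  define F where "F = (\<lambda>x. indicator T x *\<^sub>R f x)"
  have F: "F \<in> borel_measurable lebesgue" "integrable lebesgue (\<lambda>x. (cmod (F x))\<^sup>2)"
    using f L2_space_lebesgue_on_iff[OF T, of f] by (simp_all add: F_def L2_space_def)
  have "(\<lambda>x::real. t + 1 * x) \<in> lebesgue \<rightarrow>\<^sub>M lebesgue"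
    using lebesgue_affine_measurable[of "\<lambda>x::real. 1" t] by simp
  from measurable_compose[OF this F(1)] have meas: "(\<lambda>x. F (t + 1 * x)) \<in> borel_measurable lebesgue" .
  have int: "integrable lebesgue (\<lambda>x. (cmod (F (t + 1 * x)))\<^sup>2)"
    using F(2) by (subst lebesgue_integrable_real_affine_iff[where f = "\<lambda>x. (cmod (F x))\<^sup>2"]) auto
  have eq: "(\<lambda>x. indicator S x *\<^sub>R f (x + t)) = (\<lambda>x. indicator S x *\<^sub>R F (t + 1 * x))"
    using sub by (auto simp: F_def indicator_def fun_eq_iff add.commute)
  have "(\<lambda>x. (cmod (indicator S x *\<^sub>R F (t + 1 * x)))\<^sup>2) = (\<lambda>x. indicator S x *\<^sub>R (cmod (F (t + 1 * x)))\<^sup>2)"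
    by (auto simp: indicator_def fun_eq_iff)
  then have "integrable lebesgue (\<lambda>x. (cmod (indicator S x *\<^sub>R F (t + 1 * x)))\<^sup>2)"
    using integrable_mult_indicator[OF S int] by simp
  moreover have "(\<lambda>x. indicator S x *\<^sub>R F (t + 1 * x)) \<in> borel_measurable lebesgue"
    using S meas by (intro borel_measurable_scaleR borel_measurable_indicator)
  ultimately have "(\<lambda>x. indicator S x *\<^sub>R F (t + 1 * x)) \<in> L2_space lebesgue"
    by (simp add: L2_space_def)
  then show ?thesis
    unfolding L2_space_lebesgue_on_iff[OF S] eq .
qed

lemma L2_space_glue:
  assumes S: "S \<in> sets lebesgue" and T: "T \<in> sets lebesgue" and disj: "S \<inter> T = {}"
    and f: "f \<in> L2_space (lebesgue_on S)" and g: "g \<in> L2_space (lebesgue_on T)"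
  shows "(\<lambda>x. if x \<in> S then f x else g x) \<in> L2_space (lebesgue_on (S \<union> T))"
proof -
  have "(\<lambda>x. indicator S x *\<^sub>R f x + indicator T x *\<^sub>R g x) \<in> L2_space lebesgue"
    using f g S T by (intro L2_space_add) (simp_all add: L2_space_lebesgue_on_iff)
  also have "(\<lambda>x. indicator S x *\<^sub>R f x + indicator T x *\<^sub>R g x) = 
      (\<lambda>x. indicator (S \<union> T) x *\<^sub>R (if x \<in> S then f x else g x))"
    using disj by (auto simp: indicator_def fun_eq_iff)
  finally show ?thesis
    using S T by (subst L2_space_lebesgue_on_iff) auto
qed

lemma L2_space_exp_freq_mult:
  assumes "f \<in> L2_space (lebesgue_on S)"
  shows "(\<lambda>x. exp_freq \<xi> x * f x) \<in> L2_space (lebesgue_on S)"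
proof -
  have "f \<in> borel_measurable (lebesgue_on S)" using assms by (simp add: L2_space_def)
  then have "(\<lambda>x. exp_freq \<xi> x * f x) \<in> borel_measurable (lebesgue_on S)"
    by (intro borel_measurable_times exp_freq_measurable_lebesgue)
  then show ?thesis using assms by (simp add: L2_space_def norm_mult)
qed

lemma integral_lebesgue_on_singleton:
  fixes f :: "real \<Rightarrow> 'b::{banach, second_countable_topology}"
  shows "integral\<^sup>L (lebesgue_on {a}) f = 0"
proof -
  have "AE x in lebesgue. x \<notin> {a}"
    by (intro AE_not_in) (simp add: negligible_iff_null_sets[symmetric])
  then have "AE x in lebesgue. indicator {a} x *\<^sub>R f x = 0"
    by eventually_elim simp
  then show ?thesis
    by (simp add: integral_lebesgue_on_eq integral_eq_zero_AE)
qed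

text \<open>Inclusion in a lattice of frequencies is how discreteness of the spectrum is established.\<close>
lemma two_intervals_spectralI:
  assumes "1 < \<alpha>" "\<alpha> < \<beta>" and sub: "\<Lambda> \<subseteq> harmonics L" and L: "L > 0"
    and rel: "\<And>l m. l \<in> \<Lambda> \<Longrightarrow> m \<in> \<Lambda> \<Longrightarrow> l \<noteq> m \<Longrightarrow>
      exp_freq (l - m) 1 + exp_freq (l - m) \<beta> = 1 + exp_freq (l - m) \<alpha>"
    and dense: "\<And>f e. f \<in> L2_space (lebesgue_on ({0..1} \<union> {\<alpha>..\<beta>})) \<Longrightarrow> e > 0 \<Longrightarrow>
      \<exists>p. exp_poly \<Lambda> p \<and> (LINT x|lebesgue_on ({0..1} \<union> {\<alpha>..\<beta>}). (cmod (f x - p x))\<^sup>2) < e"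
  shows "spectral_set ({0..1} \<union> {\<alpha>..\<beta>})"
proof -
  let ?\<Omega> = "{0..1} \<union> {\<alpha>..\<beta>}"
  have \<Omega>: "?\<Omega> \<in> lmeasurable" by (intro fmeasurable.Un) auto
  have "measure lebesgue ?\<Omega> \<ge> measure lebesgue {0..1::real}"
    using \<Omega> by (intro measure_mono_fmeasurable) auto
  then have pos: "measure lebesgue ?\<Omega> > 0" by simp
  have "uniform_discrete (harmonics L)"
  proof (rule uniformI1)
    show "1 / L > 0" using L by simp
    fix x y assume "x \<in> harmonics L" "y \<in> harmonics L" and d: "dist x y < 1 / L"
    then obtain i j :: int where ij: "x = of_int i / L" "y = of_int j / L" by (auto simp: harmonics_def)
    then have "\<bar>of_int (i - j)\<bar> / L < 1 / L"
      using d L by (simp add: dist_real_def abs_divide flip: diff_divide_distrib)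
    then have "\<bar>of_int (i - j)\<bar> < (1::real)" using L by (simp add: divide_less_cancel)
    then have "i = j" by linarith
    then show "x = y" unfolding ij by simp
  qed
  then have disc: "discrete \<Lambda>"
    using uniform_discrete_imp_discrete discrete_subset sub by blast
  have "L2_orthogonal_basis (lebesgue_on ?\<Omega>) \<Lambda> exp_freq"
    unfolding L2_orthogonal_basis_def
  proof (intro conjI ballI allI impI)
    fix i assume "i \<in> \<Lambda>"
    show "exp_freq i \<in> L2_space (lebesgue_on ?\<Omega>)"
      by (intro L2_space_bounded[of _ _ 1] finite_measure_lebesgue_on \<Omega> exp_freq_measurable_lebesgue) auto
    show "L2_norm (lebesgue_on ?\<Omega>) (exp_freq i) \<noteq> 0"
      using pos \<Omega> by (auto simp: L2_norm_def measure_restrict_space)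
  next
    fix i j assume "i \<in> \<Lambda>" "j \<in> \<Lambda>" "i \<noteq> j"
    then show "L2_inner (lebesgue_on ?\<Omega>) (exp_freq i) (exp_freq j) = 0"
      using assms(1,2) rel by (subst L2_inner_exp_freq_two_intervals) auto
  next
    fix f and e :: real assume "f \<in> L2_space (lebesgue_on ?\<Omega>)" "e > 0"
    then obtain p where p: "exp_poly \<Lambda> p" "(LINT x|lebesgue_on ?\<Omega>. (cmod (f x - p x))\<^sup>2) < e\<^sup>2"
      using dense[of f "e\<^sup>2"] by auto
    from p(2) have "L2_norm (lebesgue_on ?\<Omega>) (\<lambda>x. f x - p x) < e"
      using \<open>e > 0\<close> by (simp add: L2_norm_less_iff)
    then show "\<exists>F c. finite F \<and> F \<subseteq> \<Lambda> \<and> L2_norm (lebesgue_on ?\<Omega>) (\<lambda>x. f x - (\<Sum>i\<in>F. c i * exp_freq i x)) < e"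
      using p(1) unfolding exp_poly_def by blast
  qed
  then show ?thesis
    unfolding spectral_set_def using \<Omega> pos disc by blast
qed

text \<open>The function g rearranges f on the interval [0, L]. An L-periodic approximation of g approximates f
  equally well, since the shift s is a multiple of L.\<close>
lemma spectral_if_quotient_integer:
  assumes \<alpha>\<beta>: "1 < \<alpha>" "\<alpha> < \<beta>" and Z: "\<beta> / (1 + \<beta> - \<alpha>) \<in> \<int>"
  shows "spectral_set ({0..1} \<union> {\<alpha>..\<beta>})"
proof -
  define L where "L = 1 + \<beta> - \<alpha>"
  have L: "L > 1" using \<alpha>\<beta> by (simp add: L_def)
  obtain m :: int where m: "\<beta> / L = of_int m" using Z by (auto simp: L_def elim: Ints_cases)
  define k where "k = m - 1"
  define s where "s = of_int k * L"
  have \<beta>: "\<beta> = L + s" using m L by (simp add: s_def k_def field_simps)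
  then have \<alpha>: "\<alpha> = 1 + s" by (simp add: L_def)
  have per: "exp_freq i s = 1" if "i \<in> harmonics L" for i
    using exp_poly_period[OF exp_poly_single[OF that, of 1], of 0 k] L by (simp add: s_def)
  have perL: "exp_freq i L = 1" if "i \<in> harmonics L" for i
    using exp_poly_period[OF exp_poly_single[OF that, of 1], of 0 1] L by simp
  show ?thesis
  proof (rule two_intervals_spectralI[OF \<alpha>\<beta> order_refl])
    show "0 < L" using L by simp
    fix i j assume "i \<in> harmonics L" "j \<in> harmonics L"
    then show "exp_freq (i - j) 1 + exp_freq (i - j) \<beta> = 1 + exp_freq (i - j) \<alpha>"
      unfolding \<alpha> \<beta> exp_freq_diff_left exp_freq_add_right by (simp add: per perL)
  next
    fix f and e :: real
    let ?\<Omega> = "{0..1} \<union> {\<alpha>..\<beta>}"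
    assume f: "f \<in> L2_space (lebesgue_on ?\<Omega>)" and "e > 0"
    have \<Omega>: "?\<Omega> \<in> lmeasurable" by (intro fmeasurable.Un) auto
    \<comment> \<open>The end point \<alpha> is split off since its counterpart 1 already belongs to the first interval.\<close>
    have \<Omega>_eq: "?\<Omega> = {\<alpha>} \<union> ({0..1} \<union> {\<alpha><..\<beta>})" using \<alpha>\<beta> by auto
    have I_eq: "{0..L} = {0..1} \<union> {1<..L}" using L by auto
    define g where "g = (\<lambda>x. if x \<in> {0..1} then f x else f (x + s))"
    have "(\<lambda>x. f (x + 0)) \<in> L2_space (lebesgue_on {0..1})"
      by (rule L2_space_translate[OF _ _ f]) auto
    moreover have "(\<lambda>x. f (x + s)) \<in> L2_space (lebesgue_on {1<..L})"
      by (rule L2_space_translate[OF _ _ f]) (auto simp: \<alpha> \<beta>)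
    ultimately have g: "g \<in> L2_space (lebesgue_on {0..L})"
      unfolding g_def I_eq by (intro L2_space_glue) auto
    obtain p where p: "exp_poly (harmonics L) p" "(LINT x|lebesgue_on {0..L}. (cmod (g x - p x))\<^sup>2) < e"
      using trigonometric_polynomials_dense_L2[OF _ g \<open>e > 0\<close>] L by auto
    have "p (x + s) = p x" for x
      using exp_poly_period[OF p(1)] L by (simp add: s_def)
    have "p \<in> L2_space (lebesgue_on {0..L})" "p \<in> L2_space (lebesgue_on ?\<Omega>)"
      using exp_poly_L2[OF p(1)] \<Omega> by auto
    from L2_space_diff[OF g this(1)] L2_space_diff[OF f this(2)]
    have int: "integrable (lebesgue_on {0..L}) (\<lambda>x. (cmod (g x - p x))\<^sup>2)" 
      "integrable (lebesgue_on ?\<Omega>) (\<lambda>x. (cmod (f x - p x))\<^sup>2)"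
      by (auto simp: L2_space_def)
    have "(\<lambda>x. f (x + 0) - p (x + 0)) \<in> L2_space (lebesgue_on ({0..1} \<union> {\<alpha><..\<beta>}))"
      by (rule L2_space_translate[OF _ _ L2_space_diff[OF f \<open>p \<in> L2_space (lebesgue_on ?\<Omega>)\<close>]]) auto
    then have "integrable (lebesgue_on ({0..1} \<union> {\<alpha><..\<beta>})) (\<lambda>x. (cmod (f x - p x))\<^sup>2)"
      by (simp add: L2_space_def)
    then have "(LINT x|lebesgue_on ({0..1} \<union> {\<alpha><..\<beta>}). (cmod (f x - p x))\<^sup>2) = 
       (LINT x|lebesgue_on {0..1}. (cmod (f x - p x))\<^sup>2) + (LINT x|lebesgue_on {\<alpha><..\<beta>}. (cmod (f x - p x))\<^sup>2)"
      using \<alpha>\<beta> by (intro integral_lebesgue_on_Un) auto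
    moreover have "(LINT x|lebesgue_on ?\<Omega>. (cmod (f x - p x))\<^sup>2) =
       (LINT x|lebesgue_on {\<alpha>}. (cmod (f x - p x))\<^sup>2) + (LINT x|lebesgue_on ({0..1} \<union> {\<alpha><..\<beta>}). (cmod (f x - p x))\<^sup>2)"
      using int(2) \<alpha>\<beta>(1) unfolding \<Omega>_eq by (intro integral_lebesgue_on_Un) auto
    ultimately have "(LINT x|lebesgue_on ?\<Omega>. (cmod (f x - p x))\<^sup>2) = 
       (LINT x|lebesgue_on {0..1}. (cmod (f x - p x))\<^sup>2) + (LINT x|lebesgue_on {\<alpha><..\<beta>}. (cmod (f x - p x))\<^sup>2)"
      by (simp only: integral_lebesgue_on_singleton add_0_left)
    also have "(LINT x|lebesgue_on {\<alpha><..\<beta>}. (cmod (f x - p x))\<^sup>2) = (LINT x|lebesgue_on {1<..L}. (cmod (f (x + s) - p (x + s)))\<^sup>2)"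
      by (intro integral_lebesgue_on_translate) (auto simp: \<alpha> \<beta>)
    also have "\<dots> = (LINT x|lebesgue_on {1<..L}. (cmod (g x - p x))\<^sup>2)"
      by (intro Bochner_Integration.integral_cong refl) (auto simp: g_def \<open>\<And>x. p (x + s) = p x\<close>)
    also have "(LINT x|lebesgue_on {0..1}. (cmod (f x - p x))\<^sup>2) = (LINT x|lebesgue_on {0..1}. (cmod (g x - p x))\<^sup>2)"
      by (intro Bochner_Integration.integral_cong refl) (auto simp: g_def)
    also have "\<dots> + (LINT x|lebesgue_on {1<..L}. (cmod (g x - p x))\<^sup>2) = (LINT x|lebesgue_on {0..L}. (cmod (g x - p x))\<^sup>2)"
      using int(1) unfolding I_eq by (intro integral_lebesgue_on_Un[symmetric]) auto
    finally have "(LINT x|lebesgue_on ?\<Omega>. (cmod (f x - p x))\<^sup>2) < e" using p(2) by simp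
    then show "\<exists>p. exp_poly (harmonics L) p \<and> (LINT x|lebesgue_on ?\<Omega>. (cmod (f x - p x))\<^sup>2) < e"
      using p(1) by blast
  qed
qed

text \<open>With c = 1 / (2 \<alpha>), shifting the argument by \<alpha> fixes the exponentials with integer frequency
  and changes the sign of the others. So p + e(c x) q has the components p + e(c x) q and
  p - e(c x) q on the two intervals; p has to approximate the half sum A of the components of f, and
  q the function B, their half difference multiplied by e(-c x). The parallelogram law adds up the errors.\<close>
lemma spectral_if_unit_intervals:
  assumes "1 < \<alpha>" and Z: "\<alpha> \<in> \<int>"
  shows "spectral_set ({0..1} \<union> {\<alpha>..\<alpha> + 1})"
proof -
  define c where "c = 1 / (2 * \<alpha>)"
  define \<Lambda> where "\<Lambda> = \<int> \<union> (\<lambda>n. n + c) ` \<int>"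
  obtain k :: int where k: "\<alpha> = of_int k" using Z by (auto elim: Ints_cases)
  have harm1: "harmonics 1 = \<int>" by (auto simp: harmonics_def Ints_def)
  have e_int: "exp_freq i n = 1" if "i \<in> \<int>" "n \<in> \<int>" for i n
    using that by (simp add: exp_freq_eq_1_iff)
  have e_c: "exp_freq c \<alpha> = -1" using assms(1) by (intro exp_freq_eq_minus_1) (simp add: c_def)
  show ?thesis
  proof (rule two_intervals_spectralI)
    show "\<Lambda> \<subseteq> harmonics (2 * \<alpha>)"
    proof
      fix x assume "x \<in> \<Lambda>"
      then obtain n :: int where "x = of_int n \<or> x = of_int n + c"
        by (auto simp: \<Lambda>_def elim!: Ints_cases)
      then have "x = of_int (2 * k * n) / (2 * \<alpha>) \<or> x = of_int (2 * k * n + 1) / (2 * \<alpha>)"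
        using assms(1) by (auto simp: k c_def field_simps)
      then show "x \<in> harmonics (2 * \<alpha>)" using in_harmonics by blast
    qed
    show "1 < \<alpha>" "\<alpha> < \<alpha> + 1" "0 < 2 * \<alpha>" using assms(1) by auto
    fix i j assume ij: "i \<in> \<Lambda>" "j \<in> \<Lambda>"
    have coset: "\<exists>a s. x = a + s \<and> a \<in> \<int> \<and> (s = 0 \<or> s = c)" if "x \<in> \<Lambda>" for x
      using that unfolding \<Lambda>_def by (metis (no_types, lifting) UnE add_0_right imageE)
    obtain a s where a: "i = a + s" "a \<in> \<int>" "s = 0 \<or> s = c" using coset[OF ij(1)] by blast
    obtain b t where b: "j = b + t" "b \<in> \<int>" "t = 0 \<or> t = c" using coset[OF ij(2)] by blast
    define n r where "n = a - b" and "r = s - t"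
    have ij: "i - j = n + r" "n \<in> \<int>" "r = 0 \<or> r = c \<or> r = - c"
      using a b by (auto simp: n_def r_def)
    have "exp_freq r \<alpha> = 1 \<and> exp_freq r 1 = 1 \<or> exp_freq r \<alpha> = -1"
      using ij(3) e_c by (auto simp: exp_freq_minus)
    then show "exp_freq (i - j) 1 + exp_freq (i - j) (\<alpha> + 1) = 1 + exp_freq (i - j) \<alpha>"
      unfolding ij(1) exp_freq_add_left exp_freq_add_right using e_int[OF ij(2)] Z by auto
  next
    fix f and e :: real
    let ?\<Omega> = "{0..1} \<union> {\<alpha>..\<alpha> + 1}"
    let ?M = "lebesgue_on {0..1::real}"
    assume f: "f \<in> L2_space (lebesgue_on ?\<Omega>)" and "e > 0"
    have \<Omega>: "?\<Omega> \<in> lmeasurable" by (intro fmeasurable.Un) auto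
    have "(\<lambda>x. f (x + 0)) \<in> L2_space ?M"
      by (rule L2_space_translate[OF _ _ f]) auto
    then have f0: "f \<in> L2_space ?M" by simp
    have f1: "(\<lambda>x. f (x + \<alpha>)) \<in> L2_space ?M"
      by (rule L2_space_translate[OF _ _ f]) auto
    define A where "A = (\<lambda>x. 1 / 2 * (f x + f (x + \<alpha>)))"
    define B where "B = (\<lambda>x. exp_freq (- c) x * (1 / 2 * (f x - f (x + \<alpha>))))"
    have A: "A \<in> L2_space ?M" 
      unfolding A_def by (intro L2_space_cmult L2_space_add f0 f1)
    have "(\<lambda>x. 1 / 2 * (f x - f (x + \<alpha>))) \<in> L2_space ?M" 
      by (intro L2_space_cmult L2_space_diff f0 f1)
    then have B: "B \<in> L2_space ?M"
      unfolding B_def by (rule L2_space_exp_freq_mult)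
    obtain p where p: "exp_poly (harmonics 1) p" "(LINT x|?M. (cmod (A x - p x))\<^sup>2) < e / 4"
      using trigonometric_polynomials_dense_L2[OF _ A, of "e / 4"] \<open>e > 0\<close> by auto
    obtain q where q: "exp_poly (harmonics 1) q" "(LINT x|?M. (cmod (B x - q x))\<^sup>2) < e / 4"
      using trigonometric_polynomials_dense_L2[OF _ B, of "e / 4"] \<open>e > 0\<close> by auto
    define r where "r = (\<lambda>x. p x + exp_freq c x * q x)"
    have r: "exp_poly \<Lambda> r"
      unfolding r_def
    proof (rule exp_poly_add)
      show "exp_poly \<Lambda> p" by (rule exp_poly_mono[OF p(1)]) (auto simp: harm1 \<Lambda>_def)
      obtain G d where G: "finite G" "G \<subseteq> \<int>" "q = (\<lambda>x. \<Sum>i\<in>G. d i * exp_freq i x)"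
        using q(1) by (auto simp: exp_poly_def harm1)
      have eq: "(\<lambda>x. exp_freq c x * q x) = (\<lambda>x. \<Sum>i\<in>G. d i * exp_freq (i + c) x)"
        unfolding G(3) by (simp add: sum_distrib_left exp_freq_add_left mult_ac)
      show "exp_poly \<Lambda> (\<lambda>x. exp_freq c x * q x)"
        unfolding eq using G(2) by (intro exp_poly_sum exp_poly_single) (auto simp: \<Lambda>_def)
    qed
    have per: "p (x + \<alpha>) = p x" "q (x + \<alpha>) = q x" for x
      using exp_poly_period[OF p(1), of x k] exp_poly_period[OF q(1), of x k] by (simp_all add: k)
    have "r \<in> L2_space (lebesgue_on ?\<Omega>)" "p \<in> L2_space ?M" "q \<in> L2_space ?M"
      using exp_poly_L2[OF r \<Omega>] exp_poly_L2[OF p(1), of "{0..1}"] exp_poly_L2[OF q(1), of "{0..1}"] by auto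
    from L2_space_diff[OF f this(1)] L2_space_diff[OF A this(2)] L2_space_diff[OF B this(3)]
    have L2: "(\<lambda>x. f x - r x) \<in> L2_space (lebesgue_on ?\<Omega>)"
      and int: "integrable (lebesgue_on ?\<Omega>) (\<lambda>x. (cmod (f x - r x))\<^sup>2)"
      "integrable ?M (\<lambda>x. (cmod (A x - p x))\<^sup>2)" "integrable ?M (\<lambda>x. (cmod (B x - q x))\<^sup>2)"
      by (auto simp: L2_space_def)
    have "(\<lambda>x. f (x + 0) - r (x + 0)) \<in> L2_space ?M" "(\<lambda>x. f (x + \<alpha>) - r (x + \<alpha>)) \<in> L2_space ?M"
      by (rule L2_space_translate[OF _ _ L2]; auto)+
    then have int': "integrable ?M (\<lambda>x. (cmod (f x - r x))\<^sup>2)" "integrable ?M (\<lambda>x. (cmod (f (x + \<alpha>) - r (x + \<alpha>)))\<^sup>2)"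
      by (auto simp: L2_space_def)
    have "(LINT x|lebesgue_on ?\<Omega>. (cmod (f x - r x))\<^sup>2) = 
       (LINT x|?M. (cmod (f x - r x))\<^sup>2) + (LINT x|lebesgue_on {\<alpha>..\<alpha> + 1}. (cmod (f x - r x))\<^sup>2)"
      using assms(1) int(1) by (intro integral_lebesgue_on_Un) auto
    also have "(LINT x|lebesgue_on {\<alpha>..\<alpha> + 1}. (cmod (f x - r x))\<^sup>2) = (LINT x|?M. (cmod (f (x + \<alpha>) - r (x + \<alpha>)))\<^sup>2)"
      by (intro integral_lebesgue_on_translate) auto
    also have "(LINT x|?M. (cmod (f x - r x))\<^sup>2) + \<dots> = 
        (LINT x|?M. (cmod (f x - r x))\<^sup>2 + (cmod (f (x + \<alpha>) - r (x + \<alpha>)))\<^sup>2)"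
      using int' by simp
    also have "\<dots> = (LINT x|?M. 2 * (cmod (A x - p x))\<^sup>2 + 2 * (cmod (B x - q x))\<^sup>2)"
    proof (intro Bochner_Integration.integral_cong refl)
      fix x
      have parallelogram: "(cmod (u + v))\<^sup>2 + (cmod (u - v))\<^sup>2 = 2 * (cmod u)\<^sup>2 + 2 * (cmod v)\<^sup>2" for u v
        unfolding cmod_power2 by (simp add: power2_eq_square algebra_simps)
      have "exp_freq c x * B x = 1 / 2 * (f x - f (x + \<alpha>))"
        unfolding B_def exp_freq_minus by (simp flip: mult.assoc)
      then have 1: "f x - r x = (A x - p x) + exp_freq c x * (B x - q x)"
        "f (x + \<alpha>) - r (x + \<alpha>) = (A x - p x) - exp_freq c x * (B x - q x)"
        unfolding A_def r_def per exp_freq_add_right e_c by (simp_all add: field_simps)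
      show "(cmod (f x - r x))\<^sup>2 + (cmod (f (x + \<alpha>) - r (x + \<alpha>)))\<^sup>2 = 
          2 * (cmod (A x - p x))\<^sup>2 + 2 * (cmod (B x - q x))\<^sup>2"
        unfolding 1 parallelogram by (simp add: norm_mult)
    qed
    also have "\<dots> < e" using int p(2) q(2) by simp
    finally show "\<exists>p. exp_poly \<Lambda> p \<and> (LINT x|lebesgue_on ?\<Omega>. (cmod (f x - p x))\<^sup>2) < e"
      using r by blast
  qed
qed

theorem corollary5p12:
  fixes \<alpha> \<beta> :: real
  assumes "1 < \<alpha>" and "\<alpha> < \<beta>"
  shows "spectral_set ({0..1} \<union> {\<alpha>..\<beta>}) \<longleftrightarrow>
           \<beta> / (1 + \<beta> - \<alpha>) \<in> \<int> \<or> (\<alpha> > 1 \<and> \<alpha> \<in> \<int> \<and> \<beta> = \<alpha> + 1)"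
proof
  assume "spectral_set ({0..1} \<union> {\<alpha>..\<beta>})"
  then obtain \<Lambda> where "L2_orthogonal_basis (lebesgue_on ({0..1} \<union> {\<alpha>..\<beta>})) \<Lambda> exp_freq"
    by (auto simp: spectral_set_def)
  from basis_two_intervals_imp[OF assms this]
  show "\<beta> / (1 + \<beta> - \<alpha>) \<in> \<int> \<or> (\<alpha> > 1 \<and> \<alpha> \<in> \<int> \<and> \<beta> = \<alpha> + 1)"
    using assms(1) by blast
next
  assume "\<beta> / (1 + \<beta> - \<alpha>) \<in> \<int> \<or> (\<alpha> > 1 \<and> \<alpha> \<in> \<int> \<and> \<beta> = \<alpha> + 1)"
  then show "spectral_set ({0..1} \<union> {\<alpha>..\<beta>})"
    using spectral_if_quotient_integer[OF assms] spectral_if_unit_intervals[of \<alpha>] by blast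
qed

end
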